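(* Let $n\in\mathbb{N}$, let $I\subseteq[n]$, $\overline J\subseteq[\overline n]$ with $|I|\ge2$ and $|\overline J|\ge 3$, and let $\mathsf h$ be as in the context. Then the support (union of all cells) of $\mathrm{Cyclo}_{I,\overline J}(\mathsf h)$ is convex if and only if no two elements of $\overline J$ are cyclically consecutive in $I\sqcup\overline J$. In this case, $\mathrm{Cyclo}_{I,\overline J}(\mathsf h)$ is a regular polyhedral subdivision of a classical cyclohedron of dimension $|\overline J|-1$.
   Context: $[n]=\{0,\dots,n\}$, $[\overline n]=\{\overline 0,\dots,\overline n\}$; $I\sqcup\overline J$ is totally ordered by $i\prec\overline i\prec i+1$, and two elements are cyclically consecutive if they are consecutive in this order or are the first and the last element. Differences are modulo $n+1$ with representatives in $\{0,\dots,n\}$; arcs $(i,\overline j),(i',\overline{j'})$ cyclically cross if ($j-i'<j-i$ and $j-i'<j'-i'$) or ($j'-i<j-i$ and $j'-i<j'-i'$); cyclic $(I,\overline J)$-trees are maximal sets of pairwise non-cyclically-crossing arcs. $\mathsf h: I\times\overline J\to\mathbb{R}$ is a height function whose induced regular triangulation of $\Delta_I\times\Delta_{\overline J}$ is the one whose maximal simplices are $\operatorname{conv}\{(\mathbf e_i,\mathbf e_{\overline j}):(i,\overline j)\in T\}$ for cyclic $(I,\overline J)$-trees $T$. For $i\in I$, $H_i=\{x\in\mathbb{R}^{\overline J}:\max_{\overline j}(x_{\overline j}-\mathsf h(i,\overline j))$ attained at least twice$\}$. With $\overline j_{\max}=\max\overline J$, $\mathrm{Cyclo}_{I,\overline J}(\mathsf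 h)$ is the polyhedral complex of bounded cells of the subdivision of $\{x:x_{\overline j_{\max}}=0\}$ induced by $(H_i)_{i\in I}$ (cells: closures of sets of points with equal maximizing index sets for all $i$). A classical cyclohedron is a polytope combinatorially equivalent to the type $B$ generalized associahedron (dual to the complex of centrally symmetric sets of non-crossing diagonals of a centrally symmetric polygon). *)

theory Defs
  imports "HOL-Analysis.Analysis"
begin

text \<open>
  The index sets \<open>I\<close> and \<open>J\<close> are sets of naturals contained in \<open>{0..n}\<close>; the overlined copy is
  told apart from \<open>I\<close> by its role only (second component of an arc, right summand of a disjoint sum).
  The coordinate spaces over \<open>I\<close> and \<open>J\<close> are \<open>real ^ 'i\<close> and \<open>real ^ 'j\<close>, whose coordinates are
  labelled by bijections \<open>\<iota>\<close> from \<open>'i\<close> onto \<open>I\<close> and \<open>\<kappa>\<close> from \<open>'j\<close> onto \<open>J\<close>.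
\<close>

section \<open>Cyclic trees\<close>

definition cdiff :: "nat \<Rightarrow> nat \<Rightarrow> nat \<Rightarrow> int" where
  "cdiff n a b = (int a - int b) mod (int n + 1)"

definition cyc_cross :: "nat \<Rightarrow> nat \<times> nat \<Rightarrow> nat \<times> nat \<Rightarrow> bool" where
  "cyc_cross n p q = (case (p, q) of ((i, j), (i', j')) \<Rightarrow>
     (cdiff n j i' < cdiff n j i \<and> cdiff n j i' < cdiff n j' i') \<or>
     (cdiff n j' i < cdiff n j i \<and> cdiff n j' i < cdiff n j' i'))"

definition noncrossing_arcs :: "nat \<Rightarrow> nat set \<Rightarrow> nat set \<Rightarrow> (nat \<times> nat) set \<Rightarrow> bool" where
  "noncrossing_arcs n I J T \<longleftrightarrow> T \<subseteq> I \<times> J \<and> (\<forall>p\<in>T. \<forall>q\<in>T. \<not> cyc_cross n p q)"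

definition cyclic_trees :: "nat \<Rightarrow> nat set \<Rightarrow> nat set \<Rightarrow> (nat \<times> nat) set set" where
  "cyclic_trees n I J =
     {T. noncrossing_arcs n I J T \<and> (\<forall>T'. noncrossing_arcs n I J T' \<and> T \<subseteq> T' \<longrightarrow> T' = T)}"

section \<open>Cyclically consecutive elements of the disjoint union\<close>

text \<open>\<open>Inl i\<close> is the plain element \<open>i\<close>, and \<open>Inr j\<close> the overlined one.\<close>

fun before :: "nat + nat \<Rightarrow> nat + nat \<Rightarrow> bool" where
  "before (Inl a) (Inl b) \<longleftrightarrow> a < b"
| "before (Inl a) (Inr b) \<longleftrightarrow> a \<le> b"
| "before (Inr a) (Inl b) \<longleftrightarrow> a < b"
| "before (Inr a) (Inr b) \<longleftrightarrow> a < b"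

definition consecutive :: "(nat + nat) set \<Rightarrow> nat + nat \<Rightarrow> nat + nat \<Rightarrow> bool" where
  "consecutive S x y \<longleftrightarrow> x \<in> S \<and> y \<in> S \<and> before x y \<and> \<not> (\<exists>z\<in>S. before x z \<and> before z y)"

definition first_and_last :: "(nat + nat) set \<Rightarrow> nat + nat \<Rightarrow> nat + nat \<Rightarrow> bool" where
  "first_and_last S x y \<longleftrightarrow>
     x \<in> S \<and> y \<in> S \<and> (\<forall>z\<in>S. z = x \<or> before x z) \<and> (\<forall>z\<in>S. z = y \<or> before z y)"

definition cyc_consecutive :: "(nat + nat) set \<Rightarrow> nat + nat \<Rightarrow> nat + nat \<Rightarrow> bool" where
  "cyc_consecutive S x y \<longleftrightarrow> x \<noteq> y \<and>
     (consecutive S x y \<or> consecutive S y x \<or> first_and_last S x y \<or> first_and_last S y x)"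

section \<open>Regular subdivisions\<close>

text \<open>
  The cells are the projections of the lower faces of the lifted configuration, that is, of the faces
  on which a functional \<open>(x, t) \<mapsto> t - c \<bullet> x\<close> is minimal. These are the nonempty cells of all dimensions.
\<close>

definition regular_subdivision :: "('k \<Rightarrow> 'a::euclidean_space) \<Rightarrow> ('k \<Rightarrow> real) \<Rightarrow> 'k set \<Rightarrow> 'a set set"
  where "regular_subdivision a w K =
    (let Q = convex hull ((\<lambda>k. (a k, w k)) ` K) in
     {fst ` {z \<in> Q. \<forall>z'\<in>Q. snd z - c \<bullet> fst z \<le> snd z' - c \<bullet> fst z'} | c. True})"

definition is_regular_subdivision_of :: "'a::euclidean_space set set \<Rightarrow> 'a set \<Rightarrow> bool" where
  "is_regular_subdivision_of S P \<longleftrightarrow>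
     (\<exists>V w. finite V \<and> P = convex hull V \<and> S = regular_subdivision (\<lambda>v. v) w V)"

definition maximal_cells :: "'a set set \<Rightarrow> 'a set set" where
  "maximal_cells S = {C \<in> S. \<forall>D\<in>S. C \<subseteq> D \<longrightarrow> D = C}"

section \<open>Height functions inducing the cyclic triangulation\<close>

definition simplex_product_point :: "'i::finite \<times> 'j::finite \<Rightarrow> (real ^ 'i) \<times> (real ^ 'j)" where
  "simplex_product_point p = (axis (fst p) 1, axis (snd p) 1)"

definition cyclic_height ::
  "nat \<Rightarrow> ('i::finite \<Rightarrow> nat) \<Rightarrow> ('j::finite \<Rightarrow> nat) \<Rightarrow> (nat \<Rightarrow> nat \<Rightarrow> real) \<Rightarrow> bool" where
  "cyclic_height n \<iota> \<kappa> h \<longleftrightarrow>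
     maximal_cells (regular_subdivision simplex_product_point (\<lambda>(a, b). h (\<iota> a) (\<kappa> b)) UNIV) =
     {convex hull (simplex_product_point ` {(a, b). (\<iota> a, \<kappa> b) \<in> T}) | T.
        T \<in> cyclic_trees n (range \<iota>) (range \<kappa>)}"

section \<open>The complex of bounded cells\<close>

text \<open>A point lies on the tropical hyperplane of \<open>i\<close> iff \<open>argmax_set \<kappa> h i x\<close> has at least two elements.\<close>

definition argmax_set :: "('j::finite \<Rightarrow> nat) \<Rightarrow> (nat \<Rightarrow> nat \<Rightarrow> real) \<Rightarrow> nat \<Rightarrow> real ^ 'j \<Rightarrow> 'j set" where
  "argmax_set \<kappa> h i x = {b. \<forall>b'. x $ b' - h i (\<kappa> b') \<le> x $ b - h i (\<kappa> b)}"

definition last_coord_zero :: "('j::finite \<Rightarrow> nat) \<Rightarrow> (real ^ 'j) set" where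
  "last_coord_zero \<kappa> = {x. \<forall>b. \<kappa> b = Max (range \<kappa>) \<longrightarrow> x $ b = 0}"

definition arrangement_cells ::
  "nat set \<Rightarrow> ('j::finite \<Rightarrow> nat) \<Rightarrow> (nat \<Rightarrow> nat \<Rightarrow> real) \<Rightarrow> (real ^ 'j) set set" where
  "arrangement_cells I \<kappa> h =
     {closure {y \<in> last_coord_zero \<kappa>. \<forall>i\<in>I. argmax_set \<kappa> h i y = argmax_set \<kappa> h i x} | x.
        x \<in> last_coord_zero \<kappa>}"

definition Cyclo ::
  "nat set \<Rightarrow> ('j::finite \<Rightarrow> nat) \<Rightarrow> (nat \<Rightarrow> nat \<Rightarrow> real) \<Rightarrow> (real ^ 'j) set set" where
  "Cyclo I \<kappa> h = {C \<in> arrangement_cells I \<kappa> h. bounded C}"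

section \<open>Classical cyclohedra\<close>

text \<open>
  The vertices of the polygon are \<open>0, \<dots>, 2 d + 1\<close> in cyclic order; its central symmetry is
  \<open>v \<mapsto> v + d + 1\<close> modulo \<open>2 d + 2\<close>. A set of diagonals is centrally symmetric iff it is mapped to itself.
\<close>

definition diagonals :: "nat \<Rightarrow> nat set set" where
  "diagonals m = {{u, v} | u v. u < m \<and> v < m \<and> u \<noteq> v \<and> (u + 1) mod m \<noteq> v \<and> (v + 1) mod m \<noteq> u}"

definition diagonals_cross :: "nat set \<Rightarrow> nat set \<Rightarrow> bool" where
  "diagonals_cross D E \<longleftrightarrow>
     (\<exists>s t u v. s < t \<and> t < u \<and> u < v \<and>
        (D = {s, u} \<and> E = {t, v} \<or> D = {t, v} \<and> E = {s, u}))"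

definition symmetric_dissections :: "nat \<Rightarrow> nat set set set" where
  "symmetric_dissections d =
     {X. X \<subseteq> diagonals (2 * d + 2) \<and> (\<forall>D\<in>X. \<forall>E\<in>X. \<not> diagonals_cross D E) \<and>
         (\<lambda>D. (\<lambda>v. (v + d + 1) mod (2 * d + 2)) ` D) ` X = X}"

text \<open>
  A \<open>d\<close>-dimensional polytope whose nonempty faces, ordered by reverse inclusion, form the face poset
  (with the empty set as least element) of the complex of symmetric dissections.
\<close>

definition classical_cyclohedron :: "nat \<Rightarrow> 'a::euclidean_space set \<Rightarrow> bool" where
  "classical_cyclohedron d P \<longleftrightarrow> polytope P \<and> aff_dim P = int d \<and>
     (\<exists>\<phi>. bij_betw \<phi> {F. F face_of P \<and> F \<noteq> {}} (symmetric_dissections d) \<and>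
        (\<forall>F G. F face_of P \<and> F \<noteq> {} \<and> G face_of P \<and> G \<noteq> {} \<longrightarrow> (F \<subseteq> G \<longleftrightarrow> \<phi> G \<subseteq> \<phi> F)))"

end

theory Submission
  imports Defs
begin

text \<open>
  For a point \<open>x\<close> let \<open>T(x)\<close> be the set of arcs \<open>(i, j)\<close> such that \<open>j\<close> is a maximiser for \<open>i\<close>. By the
  assumption on the height all these sets are noncrossing, and every cyclic tree is one of them. A
  cell is bounded iff its arcs cover \<open>J\<close>, so the support consists of the points whose arcs cover \<open>J\<close>.

  Suppose that two elements of \<open>J\<close> are consecutive. Then there are \<open>i0\<close> and its next two elements
  \<open>b1\<close>, \<open>b2\<close> of \<open>J\<close> without any element of \<open>I\<close> in between. The segment from the apex of the tropical
  hyperplane of \<open>i0\<close> to the apex of another one leaves the support immediately, because \<open>b2\<close> is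
  uncovered near the first apex.

  Otherwise every \<open>j\<close> has a cyclic predecessor \<open>p j\<close> in \<open>I\<close>, and \<open>j\<close> is covered iff \<open>(p j, j)\<close>
  belongs to \<open>T(x)\<close>, because any other arc at \<open>j\<close> crosses any other arc at \<open>p j\<close>. Hence the support
  is a polytope cut out by linear inequalities. Its faces correspond to the noncrossing sets of arcs
  \<open>(p j, j')\<close>, \<open>j \<noteq> j'\<close>: each such set extends to a cyclic tree, from which the superfluous arcs are
  removed one by one by moving along the indicator of a cut. Unrolling the circle turns arcs into
  orbits of diagonals of a centrally symmetric polygon. The subdivision is induced by the convex
  function \<open>\<Sum>i\<in>I. max j. x j - h i j\<close>, whose domains of linearity are the maximal cells.
\<close>

section \<open>Heights and noncrossing argmax patterns\<close>

text \<open>The minimisers of a linear functional on the lifted polytope form a face, and a face of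
  the hull of finitely many points is the hull of some of them, here of those with minimal value.
  The projection is linear and so commutes with the hull.\<close>

lemma regular_subdivision_cell:
  fixes a :: "'k \<Rightarrow> 'a::euclidean_space" and w :: "'k \<Rightarrow> real"
  assumes "finite K" "K \<noteq> {}"
  defines "Q \<equiv> convex hull ((\<lambda>k. (a k, w k)) ` K)"
  shows "fst ` {z \<in> Q. \<forall>z'\<in>Q. snd z - c \<bullet> fst z \<le> snd z' - c \<bullet> fst z'} =
         convex hull (a ` {k \<in> K. \<forall>k'\<in>K. w k - c \<bullet> a k \<le> w k' - c \<bullet> a k'})"
proof -
  define G where "G = (\<lambda>k. (a k, w k))"
  define f where "f = (\<lambda>z::'a \<times> real. snd z - c \<bullet> fst z)"
  define v where "v = (- c, 1::real)"
  have fv: "f z = v \<bullet> z" for z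
    by (cases z) (simp add: f_def v_def)
  define \<mu> where "\<mu> = Min ((f \<circ> G) ` K)"
  define K' where "K' = {k \<in> K. f (G k) = \<mu>}"
  have \<mu>: "\<mu> \<le> f (G k)" if "k \<in> K" for k
    unfolding \<mu>_def using assms that by (intro Min_le) auto
  have K'_ne: "K' \<noteq> {}"
  proof -
    have "\<mu> \<in> (f \<circ> G) ` K"
      unfolding \<mu>_def using assms by (intro Min_in) auto
    then show ?thesis
      by (auto simp: K'_def)
  qed
  have Q: "Q = convex hull (G ` K)"
    by (simp add: Q_def G_def)
  have Qge: "v \<bullet> z \<ge> \<mu>" if "z \<in> Q" for z
  proof -
    have "Q \<subseteq> {z. v \<bullet> z \<ge> \<mu>}"
      unfolding Q using \<mu> by (intro hull_minimal) (auto simp: fv convex_halfspace_ge)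
    then show ?thesis
      using that by auto
  qed
  have sub: "convex hull (G ` K') \<subseteq> Q \<inter> {z. v \<bullet> z = \<mu>}"
  proof (intro Int_greatest)
    show "convex hull (G ` K') \<subseteq> Q"
      unfolding Q K'_def by (intro hull_mono) auto
    show "convex hull (G ` K') \<subseteq> {z. v \<bullet> z = \<mu>}"
      by (intro hull_minimal) (auto simp: K'_def fv convex_hyperplane)
  qed
  have "Q \<inter> {z. v \<bullet> z = \<mu>} face_of convex hull (G ` K)"
    using Qge unfolding Q by (intro face_of_Int_supporting_hyperplane_ge) auto
  then obtain S where S: "S \<subseteq> G ` K" "Q \<inter> {z. v \<bullet> z = \<mu>} = convex hull S"
    by (rule face_of_convex_hull_subset[rotated]) (auto simp: assms(1) finite_imp_compact)
  have "S \<subseteq> G ` K'"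
  proof
    fix z assume z: "z \<in> S"
    then have "z \<in> Q \<inter> {z. v \<bullet> z = \<mu>}"
      using S(2) hull_subset[of S convex] by blast
    then show "z \<in> G ` K'"
      using z S(1) by (auto simp: K'_def fv)
  qed
  then have eq: "Q \<inter> {z. v \<bullet> z = \<mu>} = convex hull (G ` K')"
    using sub S(2) hull_mono[of S "G ` K'" convex] by auto
  obtain k0 where k0: "k0 \<in> K'"
    using K'_ne by auto
  then have k0Q: "G k0 \<in> Q" "f (G k0) = \<mu>"
    unfolding Q by (auto simp: K'_def intro: hull_inc)
  have "{z \<in> Q. \<forall>z'\<in>Q. f z \<le> f z'} = Q \<inter> {z. v \<bullet> z = \<mu>}"
  proof (intro set_eqI iffI)
    fix z assume "z \<in> {z \<in> Q. \<forall>z'\<in>Q. f z \<le> f z'}"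
    then have "z \<in> Q" "f z \<le> \<mu>"
      using k0Q by force+
    then show "z \<in> Q \<inter> {z. v \<bullet> z = \<mu>}"
      using Qge[of z] by (simp add: fv)
  qed (use Qge in \<open>auto simp: fv\<close>)
  moreover have "{k \<in> K. \<forall>k'\<in>K. f (G k) \<le> f (G k')} = K'"
  proof (intro set_eqI iffI)
    fix k assume "k \<in> {k \<in> K. \<forall>k'\<in>K. f (G k) \<le> f (G k')}"
    then have "k \<in> K" "f (G k) \<le> \<mu>"
      using k0 by (auto simp: K'_def)
    then show "k \<in> K'"
      using \<mu>[of k] by (simp add: K'_def)
  qed (use \<mu> in \<open>auto simp: K'_def\<close>)
  moreover have "fst ` (convex hull (G ` K')) = convex hull (fst ` G ` K')"
    by (rule convex_hull_linear_image) (rule linear_fst)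
  ultimately show ?thesis
    using eq by (simp add: f_def G_def image_image)
qed

lemma regular_subdivision_eq:
  assumes "finite K" "K \<noteq> {}"
  shows "regular_subdivision a w K =
    {convex hull (a ` {k \<in> K. \<forall>k'\<in>K. w k - c \<bullet> a k \<le> w k' - c \<bullet> a k'}) | c. True}"
  unfolding regular_subdivision_def Let_def regular_subdivision_cell[OF assms] ..

text \<open>The inner product of two such points counts the components in which their indices agree.
  It is 2 at \<open>p\<close> itself and at most 1 at every other index, so each point is a vertex
  and a hull determines its generators.\<close>

lemma simplex_product_point_in_hull:
  fixes p :: "'i::finite \<times> 'j::finite"
  assumes "simplex_product_point p \<in> convex hull (simplex_product_point ` S)"
  shows "p \<in> S"
proof (rule ccontr)
  assume "p \<notin> S"
  define v :: "(real ^ 'i) \<times> (real ^ 'j)" where "v = simplex_product_point p"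
  have v: "v \<bullet> simplex_product_point q =
      (if fst p = fst q then 1 else 0) + (if snd p = snd q then 1 else 0)" for q
    by (simp add: v_def simplex_product_point_def inner_axis_axis)
  have "v \<bullet> simplex_product_point q \<le> 1" if "q \<in> S" for q
    using \<open>p \<notin> S\<close> that unfolding v by (cases p; cases q) auto
  then have "convex hull (simplex_product_point ` S) \<subseteq> {z. v \<bullet> z \<le> 1}"
    by (intro hull_minimal) (auto simp: convex_halfspace_le)
  then show False
    using assms v[of p] by auto
qed

lemma simplex_product_hull_subset_iff:
  fixes S T :: "('i::finite \<times> 'j::finite) set"
  shows "convex hull (simplex_product_point ` S) \<subseteq> convex hull (simplex_product_point ` T) \<longleftrightarrow> S \<subseteq> T"
proof
  assume *: "convex hull (simplex_product_point ` S) \<subseteq> convex hull (simplex_product_point ` T)"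
  show "S \<subseteq> T"
  proof
    fix p assume "p \<in> S"
    then have "simplex_product_point p \<in> convex hull (simplex_product_point ` T)"
      using * by (meson hull_inc imageI subsetD)
    then show "p \<in> T"
      by (rule simplex_product_point_in_hull)
  qed
qed (intro hull_mono image_mono)

lemma simplex_product_hull_eqD:
  fixes S T :: "('i::finite \<times> 'j::finite) set"
  assumes "convex hull (simplex_product_point ` S) = convex hull (simplex_product_point ` T)"
  shows "S = T"
  using simplex_product_hull_subset_iff[of S T] simplex_product_hull_subset_iff[of T S] assms by simp

section \<open>Maximising sets and cyclic trees\<close>

lemma mem_argmax_set:
  "b \<in> argmax_set \<kappa> h i x \<longleftrightarrow> (\<forall>b'. x $ b' - h i (\<kappa> b') \<le> x $ b - h i (\<kappa> b))"
  by (simp add: argmax_set_def)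

lemma argmax_set_nonempty: "argmax_set \<kappa> h i x \<noteq> {}"
proof -
  let ?f = "\<lambda>b. x $ b - h i (\<kappa> b)"
  have "Max (range ?f) \<in> range ?f"
    by (intro Max_in) auto
  then obtain b where "?f b = Max (range ?f)"
    by force
  then have "b \<in> argmax_set \<kappa> h i x"
    by (simp add: argmax_set_def)
  then show ?thesis by auto
qed

text \<open>With \<open>u\<close> the row maxima of \<open>x\<close>, subtracting the functional
  \<open>(-u, x)\<close> leaves every arc a height of at least 0, with equality on the arcs to
  maximisers. These arcs therefore lie in one cell, hence in a maximal one, which comes from a
  cyclic tree.\<close>

lemma argmax_set_noncrossing:
  fixes \<iota> :: "'i::finite \<Rightarrow> nat" and \<kappa> :: "'j::finite \<Rightarrow> nat"
  assumes h: "cyclic_height n \<iota> \<kappa> h"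
    and i: "i \<in> range \<iota>" "i' \<in> range \<iota>"
    and b: "b \<in> argmax_set \<kappa> h i x" "b' \<in> argmax_set \<kappa> h i' x"
  shows "\<not> cyc_cross n (i, \<kappa> b) (i', \<kappa> b')"
proof -
  let ?w = "\<lambda>(a::'i, b::'j). h (\<iota> a) (\<kappa> b)"
  define u :: "real ^ 'i" where "u = (\<chi> a. Max (range (\<lambda>b. x $ b - h (\<iota> a) (\<kappa> b))))"
  have u: "x $ b - h (\<iota> a) (\<kappa> b) \<le> u $ a" for a b
    unfolding u_def by (auto intro: Max_ge)
  have u_eq: "b \<in> argmax_set \<kappa> h (\<iota> a) x \<longleftrightarrow> u $ a = x $ b - h (\<iota> a) (\<kappa> b)" for a b
  proof
    assume "b \<in> argmax_set \<kappa> h (\<iota> a) x"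
    then show "u $ a = x $ b - h (\<iota> a) (\<kappa> b)"
      by (auto simp: u_def argmax_set_def intro!: Max_eqI)
  next
    assume "u $ a = x $ b - h (\<iota> a) (\<kappa> b)"
    then show "b \<in> argmax_set \<kappa> h (\<iota> a) x"
      using u[of _ a] by (simp add: argmax_set_def)
  qed
  define c where "c = (- u, x)"
  define S where "S = {k. \<forall>k'. ?w k - c \<bullet> simplex_product_point k \<le> ?w k' - c \<bullet> simplex_product_point k'}"
  have val: "c \<bullet> simplex_product_point (a, b) = x $ b - u $ a" for a b
    by (simp add: c_def simplex_product_point_def inner_axis)
  have inS: "(a, b) \<in> S" if "b \<in> argmax_set \<kappa> h (\<iota> a) x" for a b
  proof -
    have "h (\<iota> a) (\<kappa> b) + u $ a - x $ b \<le> h (\<iota> a') (\<kappa> b') + u $ a' - x $ b'" for a' b'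
      using that u[of b' a'] unfolding u_eq by linarith
    then show ?thesis
      by (simp add: S_def val diff_diff_eq2 add.commute)
  qed
  let ?R = "regular_subdivision simplex_product_point ?w UNIV"
  \<comment> \<open>All cells are hulls over subsets of a finite index set, so the cell of
    \<open>S\<close> lies below a maximal one.\<close>
  have "finite ?R"
  proof (rule finite_subset)
    show "?R \<subseteq> (\<lambda>S. convex hull (simplex_product_point ` S)) ` UNIV"
      by (subst regular_subdivision_eq) auto
  qed simp
  moreover have "convex hull (simplex_product_point ` S) \<in> ?R"
    by (subst regular_subdivision_eq) (simp_all add: S_def del: split_paired_Ex split_paired_All, blast)
  ultimately obtain C where C: "C \<in> ?R" "convex hull (simplex_product_point ` S) \<subseteq> C"
      "\<forall>D\<in>?R. C \<subseteq> D \<longrightarrow> D = C"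
    using finite_has_maximal2[of ?R] by metis
  then have "C \<in> maximal_cells ?R"
    by (auto simp: maximal_cells_def)
  then obtain T where T: "C = convex hull (simplex_product_point ` {(a, b). (\<iota> a, \<kappa> b) \<in> T})"
      "T \<in> cyclic_trees n (range \<iota>) (range \<kappa>)"
    using h unfolding cyclic_height_def by auto
  have "S \<subseteq> {(a, b). (\<iota> a, \<kappa> b) \<in> T}"
    using C(2) unfolding T(1) by (rule iffD1[OF simplex_product_hull_subset_iff])
  then have "(i, \<kappa> b) \<in> T" "(i', \<kappa> b') \<in> T"
    using i b inS by auto
  then show ?thesis
    using T(2) by (auto simp: cyclic_trees_def noncrossing_arcs_def)
qed

text \<open>The tree gives a cell, so some functional \<open>(u, x)\<close> is minimal exactly on
  its arcs. Inside one row the contribution of \<open>u\<close> is constant; a row that meets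
  \<open>T\<close> attains the global minimum, so its maximisers at \<open>x\<close> are exactly its
  arcs.\<close>

lemma cyclic_tree_argmax_set:
  fixes \<iota> :: "'i::finite \<Rightarrow> nat" and \<kappa> :: "'j::finite \<Rightarrow> nat"
  assumes h: "cyclic_height n \<iota> \<kappa> h" and T: "T \<in> cyclic_trees n (range \<iota>) (range \<kappa>)"
  obtains x :: "real ^ 'j"
  where "\<And>i b. (i, \<kappa> b) \<in> T \<Longrightarrow> argmax_set \<kappa> h i x = {b. (i, \<kappa> b) \<in> T}"
proof -
  let ?w = "\<lambda>(a::'i, b::'j). h (\<iota> a) (\<kappa> b)"
  let ?T = "{(a, b). (\<iota> a, \<kappa> b) \<in> T}"
  have "convex hull (simplex_product_point ` ?T) \<in>
      regular_subdivision simplex_product_point ?w UNIV"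
    using h T unfolding cyclic_height_def maximal_cells_def by blast
  then obtain c where c: "convex hull (simplex_product_point ` ?T) = convex hull (simplex_product_point `
      {k. \<forall>k'. ?w k - c \<bullet> simplex_product_point k \<le> ?w k' - c \<bullet> simplex_product_point k'})"
    by (subst (asm) regular_subdivision_eq) (simp_all del: split_paired_Ex split_paired_All, blast)
  obtain u x where ux: "c = (u, x)"
    by (cases c)
  have val: "c \<bullet> simplex_product_point (a, b) = u $ a + x $ b" for a b
    by (simp add: ux simplex_product_point_def inner_axis)
  have T_eq: "?T = {k. \<forall>k'. ?w k - c \<bullet> simplex_product_point k \<le> ?w k' - c \<bullet> simplex_product_point k'}"
    by (rule simplex_product_hull_eqD) (fact c)
  have T_iff: "(\<iota> a, \<kappa> b) \<in> T \<longleftrightarrow>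
      (\<forall>a' b'. h (\<iota> a) (\<kappa> b) - u $ a - x $ b \<le> h (\<iota> a') (\<kappa> b') - u $ a' - x $ b')" for a b
  proof -
    have "(\<iota> a, \<kappa> b) \<in> T \<longleftrightarrow> (a, b) \<in> ?T"
      by simp
    also have "\<dots> \<longleftrightarrow> (\<forall>k'. ?w (a, b) - c \<bullet> simplex_product_point (a, b) \<le> ?w k' - c \<bullet> simplex_product_point k')"
      unfolding T_eq by (rule mem_Collect_eq)
    finally show ?thesis
      by (simp add: val diff_diff_eq)
  qed
  have "argmax_set \<kappa> h i x = {b. (i, \<kappa> b) \<in> T}" if iT: "(i, \<kappa> b) \<in> T" for i b
  proof -
    have "i \<in> range \<iota>"
      using T iT by (auto simp: cyclic_trees_def noncrossing_arcs_def)
    then obtain a where a: "i = \<iota> a" by auto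
    show ?thesis
    proof (intro set_eqI iffI)
      fix b' assume "b' \<in> argmax_set \<kappa> h i x"
      then have "x $ b - h i (\<kappa> b) \<le> x $ b' - h i (\<kappa> b')"
        by (simp add: argmax_set_def)
      then show "b' \<in> {b. (i, \<kappa> b) \<in> T}"
        using iT T_iff[of a b] T_iff[of a b'] unfolding a by (smt (verit) mem_Collect_eq)
    next
      fix b' assume "b' \<in> {b. (i, \<kappa> b) \<in> T}"
      then have "h i (\<kappa> b') - u $ a - x $ b' \<le> h i (\<kappa> b'') - u $ a - x $ b''" for b''
        using T_iff[of a b'] a by auto
      then show "b' \<in> argmax_set \<kappa> h i x"
        by (simp add: argmax_set_def algebra_simps)
    qed
  qed
  then show ?thesis using that by blast
qed

section \<open>Bounded cells of the arrangement\<close>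

text \<open>At a common maximiser \<open>b\<close> the gaps \<open>f x b - f x c\<close> and
  \<open>f y b - f y c\<close> are nonnegative. Their combination with positive weights vanishes
  only if both do.\<close>

lemma argmax_set_segment:
  assumes b: "b \<in> argmax_set \<kappa> h i x" "b \<in> argmax_set \<kappa> h i y" and t: "0 < t" "t < 1"
  shows "argmax_set \<kappa> h i ((1 - t) *\<^sub>R x + t *\<^sub>R y) = argmax_set \<kappa> h i x \<inter> argmax_set \<kappa> h i y"
proof -
  define f where "f = (\<lambda>x b. x $ b - h i (\<kappa> b))"
  define z where "z = (1 - t) *\<^sub>R x + t *\<^sub>R y"
  have mem: "c \<in> argmax_set \<kappa> h i u \<longleftrightarrow> (\<forall>b'. f u b' \<le> f u c)" for c u
    by (simp add: argmax_set_def f_def)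
  have fz: "f z c = (1 - t) * f x c + t * f y c" for c
    by (simp add: f_def z_def algebra_simps)
  have le: "f x c \<le> f x b" "f y c \<le> f y b" for c
    using b by (auto simp: mem)
  have le': "(1 - t) * f x c \<le> (1 - t) * f x b" "t * f y c \<le> t * f y b" for c
    using le t by (auto intro!: mult_left_mono)
  have iff: "c \<in> argmax_set \<kappa> h i u \<longleftrightarrow> f u c = f u b" if "\<And>c. f u c \<le> f u b" for c u
    using that unfolding mem by (metis order_antisym order_refl)
  have "c \<in> argmax_set \<kappa> h i z \<longleftrightarrow> c \<in> argmax_set \<kappa> h i x \<inter> argmax_set \<kappa> h i y" for c
  proof -
    have "c \<in> argmax_set \<kappa> h i z \<longleftrightarrow> (1 - t) * f x c + t * f y c = (1 - t) * f x b + t * f y b"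
      using le' by (subst iff) (auto simp: fz intro: add_mono)
    also have "\<dots> \<longleftrightarrow> (1 - t) * f x c = (1 - t) * f x b \<and> t * f y c = t * f y b"
      using le'[of c] by linarith
    also have "\<dots> \<longleftrightarrow> f x c = f x b \<and> f y c = f y b"
      using t by simp
    finally show ?thesis
      using iff[OF le(1)] iff[OF le(2)] by simp
  qed
  then show ?thesis
    by (auto simp: z_def)
qed

text \<open>For small steps no old non-maximiser catches up, and ties among old maximisers are
  broken by \<open>v\<close>. Finiteness of \<open>I\<close> gives one bound \<open>e\<close> for
  all rows.\<close>

lemma argmax_set_local:
  assumes "finite I"
  obtains e :: real where "e > 0"
    "\<And>t i. \<lbrakk>0 < t; t < e; i \<in> I\<rbrakk> \<Longrightarrow>
       argmax_set \<kappa> h i (x + t *\<^sub>R v) =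
       {b \<in> argmax_set \<kappa> h i x. \<forall>b'\<in>argmax_set \<kappa> h i x. v $ b' \<le> v $ b}"
proof -
  define f where "f = (\<lambda>i x b. x $ b - h i (\<kappa> b))"
  have mem: "c \<in> argmax_set \<kappa> h i u \<longleftrightarrow> (\<forall>b'. f i u b' \<le> f i u c)" for c u i
    by (simp add: argmax_set_def f_def)
  have f_add: "f i (x + t *\<^sub>R v) b = f i x b + t * v $ b" for i t b
    by (simp add: f_def)
  have "\<forall>\<^sub>F t in at_right 0. \<forall>i\<in>I. \<forall>b b'. b \<in> argmax_set \<kappa> h i x \<longrightarrow> b' \<notin> argmax_set \<kappa> h i x \<longrightarrow>
          f i (x + t *\<^sub>R v) b' < f i (x + t *\<^sub>R v) b"
  proof (intro eventually_ball_finite ballI eventually_all_finite assms)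
    fix i b b' assume "i \<in> I"
    show "\<forall>\<^sub>F t in at_right 0. b \<in> argmax_set \<kappa> h i x \<longrightarrow> b' \<notin> argmax_set \<kappa> h i x \<longrightarrow>
          f i (x + t *\<^sub>R v) b' < f i (x + t *\<^sub>R v) b"
    proof (cases "b \<in> argmax_set \<kappa> h i x \<and> b' \<notin> argmax_set \<kappa> h i x")
      case True
      then have lt: "f i x b' < f i x b"
        unfolding mem by (meson dual_order.trans linorder_not_le)
      have "((\<lambda>t. f i x b + t * v $ b - (f i x b' + t * v $ b')) \<longlongrightarrow>
              f i x b + 0 * v $ b - (f i x b' + 0 * v $ b')) (at_right 0)"
        by (intro tendsto_intros)
      then have "\<forall>\<^sub>F t in at_right 0. 0 < f i x b + t * v $ b - (f i x b' + t * v $ b')"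
        by (rule order_tendstoD(1)) (use lt in simp)
      then show ?thesis
        by eventually_elim (simp add: f_add)
    qed auto
  qed
  then obtain e where e: "e > 0" "\<And>t i b b'. \<lbrakk>0 < t; t < e; i \<in> I; b \<in> argmax_set \<kappa> h i x;
      b' \<notin> argmax_set \<kappa> h i x\<rbrakk> \<Longrightarrow> f i (x + t *\<^sub>R v) b' < f i (x + t *\<^sub>R v) b"
    unfolding eventually_at_right_field by (metis (no_types, lifting))
  have "argmax_set \<kappa> h i (x + t *\<^sub>R v) =
       {b \<in> argmax_set \<kappa> h i x. \<forall>b'\<in>argmax_set \<kappa> h i x. v $ b' \<le> v $ b}"
    if t: "0 < t" "t < e" and i: "i \<in> I" for t i
  proof -
    obtain c where c: "c \<in> argmax_set \<kappa> h i x"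
      using argmax_set_nonempty by blast
    have eq: "f i x b = f i x b'" if "b \<in> argmax_set \<kappa> h i x" "b' \<in> argmax_set \<kappa> h i x" for b b'
      using that unfolding mem by (meson order_antisym)
    have le_iff: "f i (x + t *\<^sub>R v) b' \<le> f i (x + t *\<^sub>R v) b \<longleftrightarrow> v $ b' \<le> v $ b"
      if "b \<in> argmax_set \<kappa> h i x" "b' \<in> argmax_set \<kappa> h i x" for b b'
      using eq[OF that] t by (simp add: f_add)
    show ?thesis
    proof (intro set_eqI iffI)
      fix b assume b: "b \<in> argmax_set \<kappa> h i (x + t *\<^sub>R v)"
      have bx: "b \<in> argmax_set \<kappa> h i x"
      proof (rule ccontr)
        assume "b \<notin> argmax_set \<kappa> h i x"
        then show False
          using e(2)[OF t i c, of b] b by (simp add: mem not_less[symmetric])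
      qed
      then show "b \<in> {b \<in> argmax_set \<kappa> h i x. \<forall>b'\<in>argmax_set \<kappa> h i x. v $ b' \<le> v $ b}"
        using b le_iff[OF bx] unfolding mem[where u = "x + t *\<^sub>R v"] by blast
    next
      fix b assume b: "b \<in> {b \<in> argmax_set \<kappa> h i x. \<forall>b'\<in>argmax_set \<kappa> h i x. v $ b' \<le> v $ b}"
      show "b \<in> argmax_set \<kappa> h i (x + t *\<^sub>R v)"
        unfolding mem
      proof
        fix b' show "f i (x + t *\<^sub>R v) b' \<le> f i (x + t *\<^sub>R v) b"
          using b le_iff[of b b'] e(2)[OF t i, of b b'] by (cases "b' \<in> argmax_set \<kappa> h i x") auto
      qed
    qed
  qed
  then show ?thesis using that e(1) by blast
qed

section \<open>Normalisation of the last coordinate\<close>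

lemma last_coord_zero_add: "x \<in> last_coord_zero \<kappa> \<Longrightarrow> y \<in> last_coord_zero \<kappa> \<Longrightarrow> x + y \<in> last_coord_zero \<kappa>"
  and last_coord_zero_diff: "x \<in> last_coord_zero \<kappa> \<Longrightarrow> y \<in> last_coord_zero \<kappa> \<Longrightarrow> x - y \<in> last_coord_zero \<kappa>"
  and last_coord_zero_scaleR: "x \<in> last_coord_zero \<kappa> \<Longrightarrow> t *\<^sub>R x \<in> last_coord_zero \<kappa>"
  by (simp_all add: last_coord_zero_def)

lemma closed_last_coord_zero: "closed (last_coord_zero \<kappa>)"
proof -
  have "last_coord_zero \<kappa> = (\<Inter>b\<in>{b. \<kappa> b = Max (range \<kappa>)}. {x. x $ b = 0})"
    by (auto simp: last_coord_zero_def)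
  then show ?thesis
    by (auto intro!: closed_INT closed_Collect_eq continuous_intros)
qed

lemma convex_last_coord_zero: "convex (last_coord_zero \<kappa>)"
  by (rule convexI) (simp add: last_coord_zero_def)

definition last_index :: "('j::finite \<Rightarrow> nat) \<Rightarrow> 'j" where
  "last_index \<kappa> = (SOME b. \<kappa> b = Max (range \<kappa>))"

lemma last_index: "\<kappa> (last_index \<kappa>) = Max (range \<kappa>)"
proof -
  have "Max (range \<kappa>) \<in> range \<kappa>"
    by (intro Max_in) auto
  then show ?thesis
    unfolding last_index_def by (metis (mono_tags, lifting) rangeE someI)
qed

lemma last_coord_zero_iff: "inj \<kappa> \<Longrightarrow> x \<in> last_coord_zero \<kappa> \<longleftrightarrow> x $ last_index \<kappa> = 0"
  unfolding last_coord_zero_def last_index[of \<kappa>, symmetric] by (auto dest: injD)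

lemma argmax_set_translate: "argmax_set \<kappa> h i (x + (\<chi> b. s)) = argmax_set \<kappa> h i x"
  by (simp add: argmax_set_def)

lemma normalise_last_coord:
  assumes "inj \<kappa>"
  obtains s where "x + (\<chi> b. s) \<in> last_coord_zero \<kappa>"
  using that[of "- x $ last_index \<kappa>"] assms by (simp add: last_coord_zero_iff)

text \<open>Equality of maximising sets is relaxed to inclusion, which makes the set a polyhedron;
  \<open>closure_open_cell\<close> identifies it with a cell of the arrangement.\<close>

definition closed_cell ::
  "nat set \<Rightarrow> ('j::finite \<Rightarrow> nat) \<Rightarrow> (nat \<Rightarrow> nat \<Rightarrow> real) \<Rightarrow> real ^ 'j \<Rightarrow> (real ^ 'j) set" where
  "closed_cell I \<kappa> h x =
     {y \<in> last_coord_zero \<kappa>. \<forall>i\<in>I. argmax_set \<kappa> h i x \<subseteq> argmax_set \<kappa> h i y}"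

definition covering :: "nat set \<Rightarrow> ('j::finite \<Rightarrow> nat) \<Rightarrow> (nat \<Rightarrow> nat \<Rightarrow> real) \<Rightarrow> (real ^ 'j) set" where
  "covering I \<kappa> h = {x \<in> last_coord_zero \<kappa>. \<forall>b. \<exists>i\<in>I. b \<in> argmax_set \<kappa> h i x}"

section \<open>Closures and boundedness of cells\<close>

lemma closed_argmax: "closed {y. b \<in> argmax_set \<kappa> h i y}"
  unfolding mem_argmax_set by (intro closed_Collect_all closed_Collect_le continuous_intros)

lemma closed_closed_cell: "closed (closed_cell I \<kappa> h x)"
proof -
  have "closed_cell I \<kappa> h x =
      last_coord_zero \<kappa> \<inter> (\<Inter>i\<in>I. \<Inter>b\<in>argmax_set \<kappa> h i x. {y. b \<in> argmax_set \<kappa> h i y})"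
    by (auto simp: closed_cell_def)
  then show ?thesis
    by (auto intro!: closed_Int closed_INT closed_last_coord_zero closed_argmax)
qed

text \<open>Every point strictly between \<open>x\<close> and a point \<open>y\<close> of the closed
  cell has the maximising sets of \<open>x\<close> again, by \<open>argmax_set_segment\<close>; such
  points approach \<open>y\<close>.\<close>

lemma closure_open_cell:
  assumes x: "x \<in> last_coord_zero \<kappa>"
  shows "closure {y \<in> last_coord_zero \<kappa>. \<forall>i\<in>I. argmax_set \<kappa> h i y = argmax_set \<kappa> h i x} =
         closed_cell I \<kappa> h x" (is "closure ?U = _")
proof
  show "closure ?U \<subseteq> closed_cell I \<kappa> h x"
    by (intro closure_minimal closed_closed_cell) (auto simp: closed_cell_def)
  show "closed_cell I \<kappa> h x \<subseteq> closure ?U"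
  proof
    fix y assume y: "y \<in> closed_cell I \<kappa> h x"
    \<comment> \<open>Weights that tend to 0; starting at 1/2 keeps both \<open>s k\<close> and
      \<open>1 - s k\<close> positive even at \<open>k = 0\<close>.\<close>
    define s :: "nat \<Rightarrow> real" where "s = (\<lambda>k. inverse (real (Suc (Suc k))))"
    have s: "0 < 1 - s k" "1 - s k < 1" for k
      by (auto simp: s_def field_simps)
    define z where "z = (\<lambda>k. (1 - (1 - s k)) *\<^sub>R x + (1 - s k) *\<^sub>R y)"
    have "z k \<in> ?U" for k
    proof -
      have "z k \<in> last_coord_zero \<kappa>"
        using x y by (simp add: z_def closed_cell_def last_coord_zero_add last_coord_zero_scaleR)
      moreover have "argmax_set \<kappa> h i (z k) = argmax_set \<kappa> h i x" if i: "i \<in> I" for i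
      proof -
        have sub: "argmax_set \<kappa> h i x \<subseteq> argmax_set \<kappa> h i y"
          using y i by (auto simp: closed_cell_def)
        obtain b where "b \<in> argmax_set \<kappa> h i x"
          using argmax_set_nonempty by blast
        then show ?thesis
          unfolding z_def using argmax_set_segment[of b \<kappa> h i x y "1 - s k"] sub s[of k] by auto
      qed
      ultimately show ?thesis by auto
    qed
    moreover have "z \<longlonglongrightarrow> (1 - (1 - 0)) *\<^sub>R x + (1 - 0) *\<^sub>R y"
      unfolding z_def s_def
      by (intro tendsto_intros LIMSEQ_Suc[OF LIMSEQ_inverse_real_of_nat])
    ultimately show "y \<in> closure ?U"
      unfolding closure_sequential by auto
  qed
qed

lemma arrangement_cells_eq:
  "arrangement_cells I \<kappa> h = closed_cell I \<kappa> h ` last_coord_zero \<kappa>"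
  unfolding arrangement_cells_def using closure_open_cell by (fastforce simp: image_iff)

lemma self_in_closed_cell: "x \<in> last_coord_zero \<kappa> \<Longrightarrow> x \<in> closed_cell I \<kappa> h x"
  by (simp add: closed_cell_def)

lemma closed_cell_subset_covering: "x \<in> covering I \<kappa> h \<Longrightarrow> closed_cell I \<kappa> h x \<subseteq> covering I \<kappa> h"
  by (fastforce simp: closed_cell_def covering_def)

text \<open>A maximiser \<open>b\<close> of row \<open>i\<close> bounds
  \<open>x $ b' - x $ b\<close> by a difference of heights. When every \<open>b\<close> is a
  maximiser somewhere, all coordinate differences are bounded, and one coordinate is 0.\<close>

lemma bounded_covering:
  assumes "inj \<kappa>" "finite I"
  shows "bounded (covering I \<kappa> h)"
proof -
  define M where "M = (\<Sum>i\<in>I. \<Sum>b\<in>UNIV. \<Sum>b'\<in>UNIV. \<bar>h i (\<kappa> b') - h i (\<kappa> b)\<bar>)"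
  have M: "h i (\<kappa> b') - h i (\<kappa> b) \<le> M" if "i \<in> I" for i b b'
  proof -
    have "h i (\<kappa> b') - h i (\<kappa> b) \<le> \<bar>h i (\<kappa> b') - h i (\<kappa> b)\<bar>"
      by simp
    also have "\<dots> \<le> (\<Sum>b'\<in>UNIV. \<bar>h i (\<kappa> b') - h i (\<kappa> b)\<bar>)"
      by (rule member_le_sum) auto
    also have "\<dots> \<le> (\<Sum>b\<in>UNIV. \<Sum>b'\<in>UNIV. \<bar>h i (\<kappa> b') - h i (\<kappa> b)\<bar>)"
      by (rule member_le_sum) (auto intro: sum_nonneg)
    also have "\<dots> \<le> M"
      unfolding M_def using that assms by (intro member_le_sum) (auto intro: sum_nonneg)
    finally show ?thesis .
  qed
  have diff: "x $ b' - x $ b \<le> M" if "x \<in> covering I \<kappa> h" for x b b'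
  proof -
    obtain i where i: "i \<in> I" "b \<in> argmax_set \<kappa> h i x"
      using \<open>x \<in> covering I \<kappa> h\<close> by (fastforce simp: covering_def)
    then have "x $ b' - x $ b \<le> h i (\<kappa> b') - h i (\<kappa> b)"
      by (simp add: argmax_set_def algebra_simps)
    then show ?thesis
      using M[OF i(1)] by (meson order_trans)
  qed
  have "norm x \<le> (\<Sum>b\<in>(UNIV::'a set). M)" if x: "x \<in> covering I \<kappa> h" for x
  proof -
    have "x $ last_index \<kappa> = 0"
      using x assms by (simp add: covering_def last_coord_zero_iff)
    then have "\<bar>x $ b\<bar> \<le> M" for b
      using diff[OF x, of b "last_index \<kappa>"] diff[OF x, of "last_index \<kappa>" b] by auto
    then show ?thesis
      by (intro order_trans[OF norm_le_l1_cart] sum_mono)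
  qed
  then show ?thesis
    unfolding bounded_iff by blast
qed

text \<open>Lowering an uncovered coordinate \<open>c\<close> keeps all maximisers, which gives a
  ray inside the cell.\<close>

lemma unbounded_closed_cell:
  fixes \<kappa> :: "'j::finite \<Rightarrow> nat"
  assumes "inj \<kappa>" "CARD('j) \<ge> 2" and x: "x \<in> last_coord_zero \<kappa>" "x \<notin> covering I \<kappa> h"
  shows "\<not> bounded (closed_cell I \<kappa> h x)"
proof
  assume bdd: "bounded (closed_cell I \<kappa> h x)"
  obtain c where c: "\<And>i. i \<in> I \<Longrightarrow> c \<notin> argmax_set \<kappa> h i x"
    using x by (auto simp: covering_def)
  \<comment> \<open>If \<open>c\<close> is the normalised coordinate, lowering it means raising all
    the others; the shift \<open>s\<close> keeps the last coordinate at 0.\<close>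
  define s where "s = (if c = last_index \<kappa> then 1 else 0 :: real)"
  define v :: "real ^ 'j" where "v = (\<chi> b. s - (if b = c then 1 else 0))"
  have vL: "v \<in> last_coord_zero \<kappa>"
    using assms(1) by (simp add: last_coord_zero_iff v_def s_def)
  obtain b where b: "b \<noteq> c"
    using assms(2) by (metis UNIV_I card_le_Suc0_iff_eq finite not_less_eq_eq numeral_2_eq_2)
  have "v \<noteq> 0"
  proof
    assume "v = 0"
    then have "v $ b = 0" "v $ c = 0" by auto
    then show False using b by (auto simp: v_def)
  qed
  have mem: "x + t *\<^sub>R v \<in> closed_cell I \<kappa> h x" if t: "t \<ge> 0" for t
    unfolding closed_cell_def
  proof (intro CollectI conjI ballI subsetI)
    show "x + t *\<^sub>R v \<in> last_coord_zero \<kappa>"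
      using x vL by (simp add: last_coord_zero_add last_coord_zero_scaleR)
    fix i b assume i: "i \<in> I" and b: "b \<in> argmax_set \<kappa> h i x"
    have bc: "b \<noteq> c"
      using c i b by blast
    have "v $ b' \<le> v $ b" for b'
      using bc by (simp add: v_def)
    then have "t * v $ b' \<le> t * v $ b" for b'
      using t by (simp add: mult_left_mono)
    then show "b \<in> argmax_set \<kappa> h i (x + t *\<^sub>R v)"
      using b by (simp add: argmax_set_def) (smt (verit))
  qed
  obtain B where B: "\<And>y. y \<in> closed_cell I \<kappa> h x \<Longrightarrow> norm y \<le> B"
    using bdd by (auto simp: bounded_iff)
  \<comment> \<open>A step long enough to leave the ball of radius \<open>B\<close>.\<close>
  define t where "t = (B + norm x + 1) / norm v"
  have "B \<ge> 0"
    using B[OF mem[of 0]] norm_ge_zero[of "x + 0 *\<^sub>R v"] by linarith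
  then have t: "t \<ge> 0"
    by (simp add: t_def)
  have "norm (t *\<^sub>R v) = B + norm x + 1"
    using \<open>v \<noteq> 0\<close> \<open>B \<ge> 0\<close> by (simp add: t_def)
  moreover have "norm (t *\<^sub>R v) \<le> norm (x + t *\<^sub>R v) + norm x"
    using norm_triangle_ineq4[of "x + t *\<^sub>R v" x] by simp
  ultimately show False
    using B[OF mem[OF t]] by linarith
qed

lemma Cyclo_eq:
  fixes \<kappa> :: "'j::finite \<Rightarrow> nat"
  assumes "inj \<kappa>" "CARD('j) \<ge> 2" "finite I"
  shows "Cyclo I \<kappa> h = closed_cell I \<kappa> h ` covering I \<kappa> h"
proof -
  have "bounded (closed_cell I \<kappa> h x) \<longleftrightarrow> x \<in> covering I \<kappa> h" if "x \<in> last_coord_zero \<kappa>" for x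
    using that unbounded_closed_cell[OF assms(1,2)] closed_cell_subset_covering[of x I \<kappa> h]
      bounded_subset[OF bounded_covering[OF assms(1,3)]] by metis
  then show ?thesis
    unfolding Cyclo_def arrangement_cells_eq by (auto simp: covering_def)
qed

lemma Union_Cyclo:
  fixes \<kappa> :: "'j::finite \<Rightarrow> nat"
  assumes "inj \<kappa>" "CARD('j) \<ge> 2" "finite I"
  shows "\<Union> (Cyclo I \<kappa> h) = covering I \<kappa> h"
proof
  show "\<Union> (Cyclo I \<kappa> h) \<subseteq> covering I \<kappa> h"
    unfolding Cyclo_eq[OF assms] using closed_cell_subset_covering by blast
  show "covering I \<kappa> h \<subseteq> \<Union> (Cyclo I \<kappa> h)"
    unfolding Cyclo_eq[OF assms] using self_in_closed_cell by (fastforce simp: covering_def)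
qed

section \<open>Regularity and convexity of the support\<close>

definition max_val :: "('j::finite \<Rightarrow> nat) \<Rightarrow> (nat \<Rightarrow> nat \<Rightarrow> real) \<Rightarrow> nat \<Rightarrow> real ^ 'j \<Rightarrow> real" where
  "max_val \<kappa> h i x = Max (range (\<lambda>b. x $ b - h i (\<kappa> b)))"

lemma max_val_ge: "x $ b - h i (\<kappa> b) \<le> max_val \<kappa> h i x"
  unfolding max_val_def by (intro Max_ge) auto

lemma mem_argmax_set_iff: "b \<in> argmax_set \<kappa> h i x \<longleftrightarrow> max_val \<kappa> h i x = x $ b - h i (\<kappa> b)"
proof
  assume "b \<in> argmax_set \<kappa> h i x"
  then show "max_val \<kappa> h i x = x $ b - h i (\<kappa> b)"
    by (auto simp: max_val_def argmax_set_def intro!: Max_eqI)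
next
  assume "max_val \<kappa> h i x = x $ b - h i (\<kappa> b)"
  then show "b \<in> argmax_set \<kappa> h i x"
    using max_val_ge[of x _ h i \<kappa>] by (simp add: argmax_set_def)
qed

lemma max_val_segment_le:
  assumes "0 \<le> t" "t \<le> 1"
  shows "max_val \<kappa> h i ((1 - t) *\<^sub>R x + t *\<^sub>R y) \<le> (1 - t) * max_val \<kappa> h i x + t * max_val \<kappa> h i y"
proof -
  let ?z = "(1 - t) *\<^sub>R x + t *\<^sub>R y"
  obtain b where b: "b \<in> argmax_set \<kappa> h i ?z"
    using argmax_set_nonempty by blast
  have "max_val \<kappa> h i ?z = (1 - t) * (x $ b - h i (\<kappa> b)) + t * (y $ b - h i (\<kappa> b))"
    using b by (simp add: mem_argmax_set_iff algebra_simps)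
  also have "\<dots> \<le> (1 - t) * max_val \<kappa> h i x + t * max_val \<kappa> h i y"
    using assms by (intro add_mono mult_left_mono max_val_ge) auto
  finally show ?thesis .
qed

text \<open>The form of a maximiser \<open>b\<close> at the intermediate point is affine and lies
  below \<open>max_val\<close> at both ends. If \<open>max_val\<close> is affine as well, neither
  inequality can be strict.\<close>

lemma argmax_set_subset_if_affine:
  assumes t: "0 < t" "t < 1"
    and eq: "max_val \<kappa> h i ((1 - t) *\<^sub>R x + t *\<^sub>R y) = (1 - t) * max_val \<kappa> h i x + t * max_val \<kappa> h i y"
  shows "argmax_set \<kappa> h i ((1 - t) *\<^sub>R x + t *\<^sub>R y) \<subseteq> argmax_set \<kappa> h i x"
proof
  fix b assume "b \<in> argmax_set \<kappa> h i ((1 - t) *\<^sub>R x + t *\<^sub>R y)"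
  then have "(1 - t) * max_val \<kappa> h i x + t * max_val \<kappa> h i y =
      (1 - t) * (x $ b - h i (\<kappa> b)) + t * (y $ b - h i (\<kappa> b))"
    using eq by (simp add: mem_argmax_set_iff algebra_simps)
  moreover have "(1 - t) * (x $ b - h i (\<kappa> b)) \<le> (1 - t) * max_val \<kappa> h i x"
      "t * (y $ b - h i (\<kappa> b)) \<le> t * max_val \<kappa> h i y"
    using t by (intro mult_left_mono max_val_ge; simp)+
  ultimately have "(1 - t) * max_val \<kappa> h i x = (1 - t) * (x $ b - h i (\<kappa> b))"
    by linarith
  then show "b \<in> argmax_set \<kappa> h i x"
    using t by (simp add: mem_argmax_set_iff)
qed

text \<open>The convex function that lifts the complex: its \<open>i\<close>-th summand bends along
  the tropical hyperplane of \<open>i\<close>.\<close>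

definition total_val ::
  "nat set \<Rightarrow> ('j::finite \<Rightarrow> nat) \<Rightarrow> (nat \<Rightarrow> nat \<Rightarrow> real) \<Rightarrow> real ^ 'j \<Rightarrow> real" where
  "total_val I \<kappa> h x = (\<Sum>i\<in>I. max_val \<kappa> h i x)"

lemma total_val_segment_le:
  assumes "0 \<le> t" "t \<le> 1"
  shows "total_val I \<kappa> h ((1 - t) *\<^sub>R x + t *\<^sub>R y) \<le> (1 - t) * total_val I \<kappa> h x + t * total_val I \<kappa> h y"
  unfolding total_val_def sum_distrib_left sum.distrib[symmetric]
  by (intro sum_mono max_val_segment_le assms)

lemma continuous_on_total_val: "continuous_on UNIV (total_val I \<kappa> h)"
proof (rule convex_on_continuous)
  show "convex_on UNIV (total_val I \<kappa> h)"
    by (rule convex_onI) (auto intro: total_val_segment_le)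
qed simp

text \<open>A strict inequality in one convex summand would remain strict in the sum, so every row
  is affine on the segment.\<close>

lemma argmax_set_subset_if_total_affine:
  assumes "finite I" "i \<in> I" and t: "0 < t" "t < 1"
    and eq: "total_val I \<kappa> h ((1 - t) *\<^sub>R x + t *\<^sub>R y) = (1 - t) * total_val I \<kappa> h x + t * total_val I \<kappa> h y"
  shows "argmax_set \<kappa> h i ((1 - t) *\<^sub>R x + t *\<^sub>R y) \<subseteq> argmax_set \<kappa> h i x"
proof (rule argmax_set_subset_if_affine[OF t], rule ccontr)
  assume ne: "max_val \<kappa> h i ((1 - t) *\<^sub>R x + t *\<^sub>R y) \<noteq> (1 - t) * max_val \<kappa> h i x + t * max_val \<kappa> h i y"
  have le: "max_val \<kappa> h i ((1 - t) *\<^sub>R x + t *\<^sub>R y) \<le> (1 - t) * max_val \<kappa> h i x + t * max_val \<kappa> h i y" for i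
    using t by (intro max_val_segment_le) auto
  have "(\<Sum>i\<in>I. max_val \<kappa> h i ((1 - t) *\<^sub>R x + t *\<^sub>R y)) <
      (\<Sum>i\<in>I. (1 - t) * max_val \<kappa> h i x + t * max_val \<kappa> h i y)"
    using le ne assms(1,2) by (intro sum_strict_mono_ex1) (auto simp: order_less_le)
  then show False
    using eq by (simp add: total_val_def sum_distrib_left sum.distrib)
qed

text \<open>A maximiser at \<open>x0\<close> is a maximiser throughout the cell, so each
  \<open>max_val\<close> is there a single coordinate minus a constant.\<close>

lemma total_val_affine_on_cell:
  assumes "x \<in> closed_cell I \<kappa> h x0" "y \<in> closed_cell I \<kappa> h x0" "0 < t" "t < 1"
  shows "total_val I \<kappa> h ((1 - t) *\<^sub>R x + t *\<^sub>R y) = (1 - t) * total_val I \<kappa> h x + t * total_val I \<kappa> h y"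
  unfolding total_val_def sum_distrib_left sum.distrib[symmetric]
proof (rule sum.cong[OF refl])
  fix i assume i: "i \<in> I"
  obtain b where "b \<in> argmax_set \<kappa> h i x0"
    using argmax_set_nonempty by blast
  then have b: "b \<in> argmax_set \<kappa> h i x" "b \<in> argmax_set \<kappa> h i y"
    using assms i by (auto simp: closed_cell_def)
  then have "b \<in> argmax_set \<kappa> h i ((1 - t) *\<^sub>R x + t *\<^sub>R y)"
    using argmax_set_segment[OF b assms(3,4)] by simp
  then have "max_val \<kappa> h i ((1 - t) *\<^sub>R x + t *\<^sub>R y) =
      (1 - t) * (x $ b - h i (\<kappa> b)) + t * (y $ b - h i (\<kappa> b))"
    by (simp add: mem_argmax_set_iff algebra_simps)
  then show "max_val \<kappa> h i ((1 - t) *\<^sub>R x + t *\<^sub>R y) = (1 - t) * max_val \<kappa> h i x + t * max_val \<kappa> h i y"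
    using b by (simp add: mem_argmax_set_iff)
qed

text \<open>The point \<open>x0\<close> is relatively interior to its own cell: the segment from
  \<open>x\<close> can be prolonged beyond \<open>x0\<close>. The maximisers at \<open>x0\<close>
  are tied at \<open>x\<close> as well, hence tied along the direction
  \<open>x0 - x\<close>.\<close>

lemma closed_cell_extend:
  assumes "finite I" and x0: "x0 \<in> last_coord_zero \<kappa>" and x: "x \<in> closed_cell I \<kappa> h x0"
  obtains z t where "z \<in> closed_cell I \<kappa> h x0" "0 < t" "t < (1::real)" "x0 = (1 - t) *\<^sub>R x + t *\<^sub>R z"
proof -
  define v where "v = x0 - x"
  obtain e where e: "e > 0" "\<And>t i. \<lbrakk>0 < t; t < e; i \<in> I\<rbrakk> \<Longrightarrow> argmax_set \<kappa> h i (x0 + t *\<^sub>R v) =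
       {b \<in> argmax_set \<kappa> h i x0. \<forall>b'\<in>argmax_set \<kappa> h i x0. v $ b' \<le> v $ b}"
    by (rule argmax_set_local[OF assms(1)]) (rule that)
  define s where "s = e / 2"
  have s: "0 < s" "s < e"
    using e(1) by (auto simp: s_def)
  define z where "z = x0 + s *\<^sub>R v"
  have "z \<in> closed_cell I \<kappa> h x0"
    unfolding closed_cell_def
  proof (intro CollectI conjI ballI subsetI)
    show "z \<in> last_coord_zero \<kappa>"
      using x0 x unfolding z_def v_def closed_cell_def
      by (auto intro!: last_coord_zero_add last_coord_zero_scaleR last_coord_zero_diff)
    fix i b assume i: "i \<in> I" and b: "b \<in> argmax_set \<kappa> h i x0"
    have sub: "argmax_set \<kappa> h i x0 \<subseteq> argmax_set \<kappa> h i x"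
      using x i by (auto simp: closed_cell_def)
    have "v $ b' \<le> v $ b" if "b' \<in> argmax_set \<kappa> h i x0" for b'
    proof -
      have "b \<in> argmax_set \<kappa> h i x" "b' \<in> argmax_set \<kappa> h i x"
        using sub b that by auto
      then show ?thesis
        using that b by (simp add: mem_argmax_set_iff v_def)
    qed
    then show "b \<in> argmax_set \<kappa> h i z"
      unfolding z_def e(2)[OF s i] using b by auto
  qed
  moreover define t where "t = 1 / (1 + s)"
  moreover have "0 < t" "t < 1"
    using s by (auto simp: t_def)
  moreover have "x0 = (1 - t) *\<^sub>R x + t *\<^sub>R z"
  proof -
    have t: "t * (1 + s) = 1"
      using s by (simp add: t_def)
    have "(1 - t) *\<^sub>R x + t *\<^sub>R z = (t * (1 + s)) *\<^sub>R x0 + (1 - t * (1 + s)) *\<^sub>R x"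
      by (simp add: z_def v_def algebra_simps)
    then show ?thesis
      by (simp add: t)
  qed
  ultimately show ?thesis using that by blast
qed

lemma convex_closed_cell: "convex (closed_cell I \<kappa> h x0)"
proof -
  have *: "convex {y. b \<in> argmax_set \<kappa> h i y}" for b i
  proof -
    have "{y. b \<in> argmax_set \<kappa> h i y} =
        (\<Inter>b'. {y. (axis b' 1 - axis b 1) \<bullet> y \<le> h i (\<kappa> b') - h i (\<kappa> b)})"
      by (auto simp: argmax_set_def inner_diff_left inner_axis' algebra_simps)
    then show ?thesis
      by (simp add: convex_INT convex_halfspace_le)
  qed
  have "closed_cell I \<kappa> h x0 =
      last_coord_zero \<kappa> \<inter> (\<Inter>i\<in>I. \<Inter>b\<in>argmax_set \<kappa> h i x0. {y. b \<in> argmax_set \<kappa> h i y})"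
    by (auto simp: closed_cell_def)
  then show ?thesis
    by (auto intro!: convex_Int convex_INT convex_last_coord_zero *)
qed

lemma compact_covering:
  assumes "inj \<kappa>" "finite I"
  shows "compact (covering I \<kappa> h)"
proof -
  have "covering I \<kappa> h = last_coord_zero \<kappa> \<inter> (\<Inter>b. \<Union>i\<in>I. {y. b \<in> argmax_set \<kappa> h i y})"
    by (auto simp: covering_def)
  then have "closed (covering I \<kappa> h)"
    using assms(2) by (auto intro!: closed_Int closed_INT closed_UN closed_last_coord_zero closed_argmax)
  then show ?thesis
    using bounded_covering[OF assms] by (simp add: compact_eq_bounded_closed)
qed

lemma closed_cell_trans:
  "y \<in> closed_cell I \<kappa> h x \<Longrightarrow> closed_cell I \<kappa> h y \<subseteq> closed_cell I \<kappa> h x"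
  by (fastforce simp: closed_cell_def)

lemma compact_closed_cell:
  assumes "inj \<kappa>" "finite I" "x \<in> covering I \<kappa> h"
  shows "compact (closed_cell I \<kappa> h x)"
  using bounded_subset[OF bounded_covering[OF assms(1,2)] closed_cell_subset_covering[OF assms(3)]]
  by (simp add: compact_eq_bounded_closed closed_closed_cell)

text \<open>Any other point of the cell would, by \<open>closed_cell_extend\<close>, put
  \<open>v\<close> inside an open segment of \<open>S\<close>.\<close>

lemma extreme_point_closed_cell:
  assumes "finite I" "v \<in> last_coord_zero \<kappa>" "v extreme_point_of S" "closed_cell I \<kappa> h v \<subseteq> S"
  shows "closed_cell I \<kappa> h v = {v}"
proof -
  have "y = v" if y: "y \<in> closed_cell I \<kappa> h v" for y
  proof (rule ccontr)
    assume "y \<noteq> v"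
    obtain z t where z: "z \<in> closed_cell I \<kappa> h v" "0 < t" "t < (1::real)" "v = (1 - t) *\<^sub>R y + t *\<^sub>R z"
      using closed_cell_extend[OF assms(1,2) y] by metis
    have "y \<noteq> z"
      using z \<open>y \<noteq> v\<close> by (auto simp flip: scaleR_add_left)
    then have "v \<in> open_segment y z"
      using z(2-4) by (auto simp: in_segment)
    then show False
      using assms(3,4) y z(1) by (auto simp: extreme_point_of_def)
  qed
  then show ?thesis
    using self_in_closed_cell[OF assms(2)] by auto
qed

definition arrangement_vertices ::
  "nat set \<Rightarrow> ('j::finite \<Rightarrow> nat) \<Rightarrow> (nat \<Rightarrow> nat \<Rightarrow> real) \<Rightarrow> (real ^ 'j) set" where
  "arrangement_vertices I \<kappa> h = {v \<in> covering I \<kappa> h. closed_cell I \<kappa> h v = {v}}"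

text \<open>The maximising sets determine a vertex, because a vertex with the same sets as
  \<open>v\<close> lies in the cell \<open>{v}\<close>; there are only finitely many families of
  such sets.\<close>

lemma finite_arrangement_vertices:
  fixes \<kappa> :: "'j::finite \<Rightarrow> nat"
  assumes "finite I"
  shows "finite (arrangement_vertices I \<kappa> h)"
proof (rule inj_on_finite)
  let ?pat = "\<lambda>v. \<lambda>i\<in>I. argmax_set \<kappa> h i v"
  show "inj_on ?pat (arrangement_vertices I \<kappa> h)"
  proof (rule inj_onI)
    fix v w assume v: "v \<in> arrangement_vertices I \<kappa> h" and w: "w \<in> arrangement_vertices I \<kappa> h"
      and eq: "?pat v = ?pat w"
    have "argmax_set \<kappa> h i v = argmax_set \<kappa> h i w" if "i \<in> I" for i
      using fun_cong[OF eq, of i] that by simp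
    then have "w \<in> closed_cell I \<kappa> h v"
      using w by (simp add: closed_cell_def arrangement_vertices_def covering_def)
    then show "v = w"
      using v by (simp add: arrangement_vertices_def)
  qed
  show "?pat ` arrangement_vertices I \<kappa> h \<subseteq> I \<rightarrow>\<^sub>E (UNIV :: 'j set set)"
    by auto
  show "finite (I \<rightarrow>\<^sub>E (UNIV :: 'j set set))"
    by (intro finite_PiE assms) auto
qed

text \<open>Krein-Milman: in a compact convex union of cells every extreme point is a vertex of the
  arrangement. This serves both for the whole support and for single cells.\<close>

lemma hull_vertices:
  assumes "finite I" and S: "compact S" "convex S" "S \<subseteq> covering I \<kappa> h"
    and cells: "\<And>v. v \<in> S \<Longrightarrow> closed_cell I \<kappa> h v \<subseteq> S"
  shows "S = convex hull (arrangement_vertices I \<kappa> h \<inter> S)"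
proof
  have "{v. v extreme_point_of S} \<subseteq> arrangement_vertices I \<kappa> h \<inter> S"
  proof
    fix v assume "v \<in> {v. v extreme_point_of S}"
    then have v: "v extreme_point_of S" "v \<in> S"
      by (auto simp: extreme_point_of_def)
    then have "v \<in> last_coord_zero \<kappa>"
      using S(3) by (auto simp: covering_def)
    then have "closed_cell I \<kappa> h v = {v}"
      using extreme_point_closed_cell[OF assms(1) _ v(1)] cells[OF v(2)] by blast
    then show "v \<in> arrangement_vertices I \<kappa> h \<inter> S"
      using v S(3) by (auto simp: arrangement_vertices_def)
  qed
  then show "S \<subseteq> convex hull (arrangement_vertices I \<kappa> h \<inter> S)"
    by (subst Krein_Milman_Minkowski[OF S(1,2)]) (rule hull_mono)
  show "convex hull (arrangement_vertices I \<kappa> h \<inter> S) \<subseteq> S"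
    using S(2) by (intro hull_minimal) auto
qed

text \<open>
  The functional \<open>c\<close> adds up, over all \<open>i\<close>, the barycentre of the maximising coordinates of \<open>x0\<close>;
  it is a subgradient of \<^const>\<open>total_val\<close> in the relative interior of the subdifferential at \<open>x0\<close>.
\<close>

lemma closed_cell_is_argmin:
  assumes "finite I" and x0: "x0 \<in> covering I \<kappa> h"
  obtains c where "closed_cell I \<kappa> h x0 = {x \<in> covering I \<kappa> h. \<forall>y\<in>covering I \<kappa> h.
      total_val I \<kappa> h x - c \<bullet> x \<le> total_val I \<kappa> h y - c \<bullet> y}"
proof -
  let ?A = "\<lambda>i. argmax_set \<kappa> h i x0"
  define r where "r = (\<lambda>i. inverse (real (card (?A i))))"
  have cA: "card (?A i) > 0" for i
    using argmax_set_nonempty[of \<kappa> h i x0] by (simp add: card_gt_0_iff)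
  have r: "r i > 0" "r i * real (card (?A i)) = 1" for i
    using cA[of i] by (simp_all add: r_def argmax_set_nonempty)
  define c where "c = (\<Sum>i\<in>I. \<Sum>b\<in>?A i. r i *\<^sub>R axis b (1::real))"
  \<comment> \<open>\<open>\<sigma>\<close> adds up the weighted slacks of the maximisers at
    \<open>x0\<close>. It differs from \<open>total_val\<close> minus the functional
    \<open>c\<close> by the constant \<open>K\<close>, is nonnegative, and vanishes exactly where
    all of them remain maximisers.\<close>
  define \<sigma> where "\<sigma> = (\<lambda>x. \<Sum>i\<in>I. \<Sum>b\<in>?A i. r i * (max_val \<kappa> h i x - (x $ b - h i (\<kappa> b))))"
  define K where "K = (\<Sum>i\<in>I. \<Sum>b\<in>?A i. r i * h i (\<kappa> b))"
  have "\<sigma> x = total_val I \<kappa> h x - c \<bullet> x + K" for x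
  proof -
    have "\<sigma> x = (\<Sum>i\<in>I. \<Sum>b\<in>?A i. r i * max_val \<kappa> h i x - r i * x $ b + r i * h i (\<kappa> b))"
      by (simp add: \<sigma>_def algebra_simps)
    also have "\<dots> = (\<Sum>i\<in>I. (r i * real (card (?A i))) * max_val \<kappa> h i x)
        - (\<Sum>i\<in>I. \<Sum>b\<in>?A i. r i * x $ b) + K"
      by (simp add: K_def sum.distrib sum_subtractf mult_ac)
    also have "(\<Sum>i\<in>I. \<Sum>b\<in>?A i. r i * x $ b) = c \<bullet> x"
      by (simp add: c_def inner_sum_left inner_axis')
    finally show ?thesis
      by (simp add: r total_val_def)
  qed
  then have val: "total_val I \<kappa> h x - c \<bullet> x \<le> total_val I \<kappa> h y - c \<bullet> y \<longleftrightarrow> \<sigma> x \<le> \<sigma> y" for x y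
    by simp
  have term_ge: "0 \<le> r i * (max_val \<kappa> h i x - (x $ b - h i (\<kappa> b)))" for i b x
    using r(1)[of i] max_val_ge[of x b h i \<kappa>] by simp
  have \<sigma>_ge: "0 \<le> \<sigma> x" for x
    unfolding \<sigma>_def by (intro sum_nonneg term_ge)
  have "\<sigma> x = 0 \<longleftrightarrow> (\<forall>i\<in>I. ?A i \<subseteq> argmax_set \<kappa> h i x)" for x
  proof -
    have "\<sigma> x = 0 \<longleftrightarrow> (\<forall>i\<in>I. \<forall>b\<in>?A i. r i * (max_val \<kappa> h i x - (x $ b - h i (\<kappa> b))) = 0)"
      unfolding \<sigma>_def using assms(1)
      by (subst sum_nonneg_eq_0_iff, simp, simp add: sum_nonneg term_ge)
        (simp only: sum_nonneg_eq_0_iff[OF finite term_ge])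
    also have "\<dots> \<longleftrightarrow> (\<forall>i\<in>I. ?A i \<subseteq> argmax_set \<kappa> h i x)"
    proof -
      have "r i * (max_val \<kappa> h i x - (x $ b - h i (\<kappa> b))) = 0 \<longleftrightarrow> b \<in> argmax_set \<kappa> h i x" for i b
        using r(1)[of i] by (simp add: mem_argmax_set_iff)
      then show ?thesis by blast
    qed
    finally show ?thesis .
  qed
  then have cell: "closed_cell I \<kappa> h x0 = {x \<in> covering I \<kappa> h. \<sigma> x = 0}"
    using closed_cell_subset_covering[OF x0] by (auto simp: closed_cell_def covering_def)
  moreover have "\<sigma> x0 = 0"
    using cell x0 self_in_closed_cell[of x0 \<kappa> I h] by (auto simp: covering_def)
  moreover have "\<sigma> x = 0 \<longleftrightarrow> (\<forall>y\<in>covering I \<kappa> h. \<sigma> x \<le> \<sigma> y)" if "\<sigma> x0 = 0" for x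
    using x0 \<sigma>_ge[of x] \<sigma>_ge that by (metis order_antisym)
  ultimately have "closed_cell I \<kappa> h x0 = {x \<in> covering I \<kappa> h. \<forall>y\<in>covering I \<kappa> h. \<sigma> x \<le> \<sigma> y}"
    by simp
  then show ?thesis
    using that[of c] by (simp add: val)
qed

text \<open>The minimisers \<open>M\<close> form a convex set. For \<open>x0\<close> in its relative
  interior, each point of \<open>M\<close> lies on a segment of \<open>M\<close> through
  \<open>x0\<close>, where \<open>total_val\<close> is affine, so the maximisers at
  \<open>x0\<close> persist on \<open>M\<close>. Conversely a segment of the cell through
  \<open>x0\<close> carries an affine function that is minimal at \<open>x0\<close>, hence
  constant.\<close>

lemma argmin_is_closed_cell:
  fixes c :: "real ^ 'j::finite"
  assumes "finite I" "inj \<kappa>" and ne: "covering I \<kappa> h \<noteq> {}" and cvx: "convex (covering I \<kappa> h)"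
  obtains x0 where "x0 \<in> covering I \<kappa> h" "closed_cell I \<kappa> h x0 = {x \<in> covering I \<kappa> h.
      \<forall>y\<in>covering I \<kappa> h. total_val I \<kappa> h x - c \<bullet> x \<le> total_val I \<kappa> h y - c \<bullet> y}"
proof -
  let ?P = "covering I \<kappa> h"
  define g where "g = (\<lambda>x. total_val I \<kappa> h x - c \<bullet> x)"
  define M where "M = {x \<in> ?P. \<forall>y\<in>?P. g x \<le> g y}"
  have "continuous_on ?P g"
    unfolding g_def by (intro continuous_intros continuous_on_subset[OF continuous_on_total_val]) auto
  then have "M \<noteq> {}"
    using continuous_attains_inf[OF compact_covering[OF assms(2,1)] ne, of g] by (auto simp: M_def)
  have g_le: "g ((1 - t) *\<^sub>R x + t *\<^sub>R y) \<le> (1 - t) * g x + t * g y" if "0 \<le> t" "t \<le> 1" for t x y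
    using total_val_segment_le[OF that, of I \<kappa> h x y]
    by (simp add: g_def inner_add_right algebra_simps)
  have g_eq: "g x = g y" if "x \<in> M" "y \<in> M" for x y
    using that by (auto simp: M_def intro: order_antisym)
  have "convex M"
    unfolding convex_alt
  proof (intro ballI allI impI)
    fix x y and t :: real assume xy: "x \<in> M" "y \<in> M" and t: "0 \<le> t \<and> t \<le> 1"
    have "(1 - t) *\<^sub>R x + t *\<^sub>R y \<in> ?P"
      using cvx xy t by (auto simp: convex_alt M_def)
    moreover have "g ((1 - t) *\<^sub>R x + t *\<^sub>R y) \<le> g x"
      using g_le[of t x y] t g_eq[OF xy] by (simp add: algebra_simps)
    ultimately show "(1 - t) *\<^sub>R x + t *\<^sub>R y \<in> M"
      using xy(1) unfolding M_def by (auto intro: order_trans)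
  qed
  then obtain x0 where x0: "x0 \<in> rel_interior M"
    using \<open>M \<noteq> {}\<close> rel_interior_eq_empty by blast
  then have x0M: "x0 \<in> M"
    using rel_interior_subset by blast
  then have x0P: "x0 \<in> ?P"
    by (simp add: M_def)
  then have x0L: "x0 \<in> last_coord_zero \<kappa>"
    by (simp add: covering_def)
  have "M \<subseteq> closed_cell I \<kappa> h x0"
  proof
    fix x assume x: "x \<in> M"
    obtain e where e: "e > 1" "(1 - e) *\<^sub>R x + e *\<^sub>R x0 \<in> M"
      using x0 x convex_rel_interior_iff[OF \<open>convex M\<close> \<open>M \<noteq> {}\<close>] by blast
    define z where "z = (1 - e) *\<^sub>R x + e *\<^sub>R x0"
    define t where "t = 1 / e"
    have t: "0 < t" "t < 1" "t * e = 1"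
      using e by (auto simp: t_def)
    have x0_eq: "x0 = (1 - t) *\<^sub>R x + t *\<^sub>R z"
    proof -
      have "(1 - t) *\<^sub>R x + t *\<^sub>R z = (1 - t * e) *\<^sub>R x + (t * e) *\<^sub>R x0"
        by (simp add: z_def algebra_simps)
      then show ?thesis by (simp add: t)
    qed
    have "g x0 = g x" "g z = g x"
      using g_eq x x0M e(2) z_def by blast+
    then have "g x0 = (1 - t) * g x + t * g z"
      by (simp add: algebra_simps)
    moreover have "c \<bullet> x0 = (1 - t) * (c \<bullet> x) + t * (c \<bullet> z)"
      by (simp add: x0_eq inner_add_right)
    ultimately have eq: "total_val I \<kappa> h x0 = (1 - t) * total_val I \<kappa> h x + t * total_val I \<kappa> h z"
      by (simp add: g_def algebra_simps)
    have "argmax_set \<kappa> h i x0 \<subseteq> argmax_set \<kappa> h i x" if "i \<in> I" for i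
      using argmax_set_subset_if_total_affine[OF assms(1) that t(1,2), of \<kappa> h x z] eq
      unfolding x0_eq[symmetric] by blast
    then show "x \<in> closed_cell I \<kappa> h x0"
      using x by (simp add: closed_cell_def M_def covering_def)
  qed
  moreover have "closed_cell I \<kappa> h x0 \<subseteq> M"
  proof
    fix x assume x: "x \<in> closed_cell I \<kappa> h x0"
    obtain z t where z: "z \<in> closed_cell I \<kappa> h x0" "0 < t" "t < (1::real)" "x0 = (1 - t) *\<^sub>R x + t *\<^sub>R z"
      using closed_cell_extend[OF assms(1) x0L x] by metis
    have P: "x \<in> ?P" "z \<in> ?P"
      using x z(1) closed_cell_subset_covering[OF x0P] by auto
    have "c \<bullet> x0 = (1 - t) * (c \<bullet> x) + t * (c \<bullet> z)"
      by (subst z(4)) (simp add: inner_add_right)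
    moreover have "total_val I \<kappa> h x0 = (1 - t) * total_val I \<kappa> h x + t * total_val I \<kappa> h z"
      using total_val_affine_on_cell[OF x z(1-3)] unfolding z(4)[symmetric] .
    ultimately have "g x0 = (1 - t) * g x + t * g z"
      by (simp add: g_def algebra_simps)
    moreover have "t * g x0 \<le> t * g z"
      using x0M P z(2) by (simp add: M_def)
    ultimately have "(1 - t) * g x \<le> (1 - t) * g x0"
      by (simp add: algebra_simps)
    then have "g x \<le> g x0"
      using z(3) by simp
    then show "x \<in> M"
      using x0M P(1) unfolding M_def by (auto intro: order_trans)
  qed
  ultimately show ?thesis
    using that[OF x0P] by (simp add: M_def g_def)
qed

definition apex :: "('j::finite \<Rightarrow> nat) \<Rightarrow> (nat \<Rightarrow> nat \<Rightarrow> real) \<Rightarrow> nat \<Rightarrow> real ^ 'j" where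
  "apex \<kappa> h i = (\<chi> b. h i (\<kappa> b) - h i (Max (range \<kappa>)))"

lemma argmax_set_apex: "argmax_set \<kappa> h i (apex \<kappa> h i) = UNIV"
  by (simp add: argmax_set_def apex_def)

lemma apex_in_covering: "i \<in> I \<Longrightarrow> apex \<kappa> h i \<in> covering I \<kappa> h"
  unfolding covering_def using argmax_set_apex[of \<kappa> h i]
  by (auto simp: last_coord_zero_def apex_def)

text \<open>The vertices are lifted by \<open>total_val\<close>. Minimising \<open>total_val\<close>
  minus a functional over the support yields exactly the cells, by
  \<open>closed_cell_is_argmin\<close> and \<open>argmin_is_closed_cell\<close>; the fact
  \<open>cell\<close> passes from the support to its vertices.\<close>

theorem convex_covering_regular_subdivision:
  fixes \<kappa> :: "'j::finite \<Rightarrow> nat"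
  assumes "finite I" "I \<noteq> {}" "inj \<kappa>" "CARD('j) \<ge> 2" and cvx: "convex (covering I \<kappa> h)"
  shows "is_regular_subdivision_of (Cyclo I \<kappa> h) (covering I \<kappa> h)"
proof -
  let ?P = "covering I \<kappa> h"
  let ?V = "arrangement_vertices I \<kappa> h"
  let ?F = "total_val I \<kappa> h"
  have ne: "?P \<noteq> {}"
    using apex_in_covering assms(2) by blast
  have VP: "?V \<subseteq> ?P"
    by (auto simp: arrangement_vertices_def)
  have P_hull: "?P = convex hull ?V"
    using hull_vertices[OF assms(1) compact_covering[OF assms(3,1)] cvx order_refl] VP
    by (metis closed_cell_subset_covering inf.absorb1)
  then have V_ne: "?V \<noteq> {}"
    using ne by auto
  have cell_hull: "closed_cell I \<kappa> h x = convex hull (?V \<inter> closed_cell I \<kappa> h x)" if "x \<in> ?P" for x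
    using that assms by (intro hull_vertices compact_closed_cell convex_closed_cell
        closed_cell_subset_covering closed_cell_trans)
  have cell: "convex hull ((\<lambda>v. v) ` {v \<in> ?V. \<forall>v'\<in>?V. ?F v - c \<bullet> v \<le> ?F v' - c \<bullet> v'}) =
      closed_cell I \<kappa> h x"
    if x: "x \<in> ?P" and M: "closed_cell I \<kappa> h x = {x \<in> ?P. \<forall>y\<in>?P. ?F x - c \<bullet> x \<le> ?F y - c \<bullet> y}" for c x
  proof -
    \<comment> \<open>The cell contains a vertex \<open>u\<close>, so the minimum over the vertices
      equals the minimum over the support.\<close>
    have "?V \<inter> closed_cell I \<kappa> h x \<noteq> {}"
      using cell_hull[OF x] self_in_closed_cell[of x \<kappa> I h] x by (auto simp: covering_def)
    then obtain u where u: "u \<in> ?V" "u \<in> closed_cell I \<kappa> h x"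
      by auto
    have "{v \<in> ?V. \<forall>v'\<in>?V. ?F v - c \<bullet> v \<le> ?F v' - c \<bullet> v'} = ?V \<inter> closed_cell I \<kappa> h x"
    proof (intro set_eqI iffI)
      fix v assume v: "v \<in> {v \<in> ?V. \<forall>v'\<in>?V. ?F v - c \<bullet> v \<le> ?F v' - c \<bullet> v'}"
      then have "?F v - c \<bullet> v \<le> ?F u - c \<bullet> u"
        using u by blast
      then have "?F v - c \<bullet> v \<le> ?F y - c \<bullet> y" if "y \<in> ?P" for y
        using u(2) that unfolding M by fastforce
      then show "v \<in> ?V \<inter> closed_cell I \<kappa> h x"
        using v VP unfolding M by blast
    qed (use VP M in auto)
    then show ?thesis
      using cell_hull[OF x] by simp
  qed
  have "Cyclo I \<kappa> h = regular_subdivision (\<lambda>v. v) ?F ?V"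
    unfolding Cyclo_eq[OF assms(3,4,1)]
      regular_subdivision_eq[OF finite_arrangement_vertices[OF assms(1)] V_ne]
  proof (intro set_eqI iffI)
    fix C assume "C \<in> closed_cell I \<kappa> h ` ?P"
    then obtain x where x: "x \<in> ?P" "C = closed_cell I \<kappa> h x"
      by auto
    obtain c where "closed_cell I \<kappa> h x = {x \<in> ?P. \<forall>y\<in>?P. ?F x - c \<bullet> x \<le> ?F y - c \<bullet> y}"
      by (rule closed_cell_is_argmin[OF assms(1) x(1)])
    from cell[OF x(1) this] show "C \<in> {convex hull (\<lambda>v. v) ` {v \<in> ?V. \<forall>v'\<in>?V.
        ?F v - c \<bullet> v \<le> ?F v' - c \<bullet> v'} |c. True}"
      using x(2) by blast
  next
    fix C assume "C \<in> {convex hull (\<lambda>v. v) ` {v \<in> ?V. \<forall>v'\<in>?V.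
        ?F v - c \<bullet> v \<le> ?F v' - c \<bullet> v'} |c. True}"
    then obtain c where c: "C = convex hull ((\<lambda>v. v) ` {v \<in> ?V. \<forall>v'\<in>?V. ?F v - c \<bullet> v \<le> ?F v' - c \<bullet> v'})"
      by blast
    obtain x where "x \<in> ?P" "closed_cell I \<kappa> h x = {x \<in> ?P. \<forall>y\<in>?P. ?F x - c \<bullet> x \<le> ?F y - c \<bullet> y}"
      by (rule argmin_is_closed_cell[OF assms(1,3) ne cvx])
    from this(1) cell[OF this] show "C \<in> closed_cell I \<kappa> h ` ?P"
      unfolding c by blast
  qed
  then show ?thesis
    unfolding is_regular_subdivision_of_def
    using finite_arrangement_vertices[OF assms(1)] P_hull by blast
qed

text \<open>
  Near the apex \<open>x1\<close> of \<open>i0\<close>, on the segment towards the apex \<open>x2\<close> of \<open>i1\<close>, no row covers \<open>b2\<close>: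
  the row \<open>i0\<close> follows \<open>x2\<close>, where \<open>b2\<close> is excluded by a crossing, and each other row follows \<open>x1\<close>.
\<close>

lemma nonconvex_covering:
  assumes "finite I" and i: "i0 \<in> I" "i1 \<in> I"
    and noncrossing: "\<And>i i' b b' x. \<lbrakk>i \<in> I; i' \<in> I; b \<in> argmax_set \<kappa> h i x; b' \<in> argmax_set \<kappa> h i' x\<rbrakk>
        \<Longrightarrow> \<not> cyc_cross n (i, \<kappa> b) (i', \<kappa> b')"
    and cross0: "\<And>i. i \<in> I \<Longrightarrow> i \<noteq> i0 \<Longrightarrow> cyc_cross n (i, \<kappa> b2) (i0, \<kappa> c)"
    and cross1: "cyc_cross n (i0, \<kappa> b2) (i1, \<kappa> b1)"
  shows "\<not> convex (covering I \<kappa> h)"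
proof
  assume cvx: "convex (covering I \<kappa> h)"
  define x1 where "x1 = apex \<kappa> h i0"
  define x2 where "x2 = apex \<kappa> h i1"
  define v where "v = x2 - x1"
  have b2: "b2 \<notin> argmax_set \<kappa> h i x1" if "i \<in> I" "i \<noteq> i0" for i
    using noncrossing[of i i0 b2 x1 c] cross0[OF that] that i argmax_set_apex[of \<kappa> h i0]
    by (auto simp: x1_def)
  have b2': "b2 \<notin> argmax_set \<kappa> h i0 x2"
    using noncrossing[of i0 i1 b2 x2 b1] cross1 i argmax_set_apex[of \<kappa> h i1]
    by (auto simp: x2_def)
  obtain e where e: "e > 0" "\<And>t i. \<lbrakk>0 < t; t < e; i \<in> I\<rbrakk> \<Longrightarrow> argmax_set \<kappa> h i (x1 + t *\<^sub>R v) =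
       {b \<in> argmax_set \<kappa> h i x1. \<forall>b'\<in>argmax_set \<kappa> h i x1. v $ b' \<le> v $ b}"
    by (rule argmax_set_local[OF assms(1)]) (rule that)
  define t where "t = min (e / 2) (1 / 2)"
  have t: "0 < t" "t < e" "t < 1"
    using e(1) by (auto simp: t_def)
  have z: "(1 - t) *\<^sub>R x1 + t *\<^sub>R x2 = x1 + t *\<^sub>R v"
    by (simp add: v_def algebra_simps)
  have "(1 - t) *\<^sub>R x1 + t *\<^sub>R x2 \<in> covering I \<kappa> h"
    using cvx apex_in_covering[OF i(1), of \<kappa> h] apex_in_covering[OF i(2), of \<kappa> h] t
    unfolding convex_alt x1_def x2_def by auto
  then obtain i where i: "i \<in> I" "b2 \<in> argmax_set \<kappa> h i ((1 - t) *\<^sub>R x1 + t *\<^sub>R x2)"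
    by (auto simp: covering_def)
  show False
  proof (cases "i = i0")
    case True
    obtain b where b: "b \<in> argmax_set \<kappa> h i0 x2"
      using argmax_set_nonempty by blast
    have "b \<in> argmax_set \<kappa> h i0 x1"
      by (simp add: x1_def argmax_set_apex)
    then show False
      using argmax_set_segment[OF _ b t(1,3)] i True b2' by blast
  next
    case False
    then show False
      using i e(2)[OF t(1,2) i(1)] b2 unfolding z by blast
  qed
qed

section \<open>Cyclically consecutive elements and crossings\<close>

lemma cdiff_eq:
  assumes "a \<le> n" "b \<le> n"
  shows "cdiff n a b = (if b \<le> a then int a - int b else int a - int b + int n + 1)"
proof (cases "b \<le> a")
  case True
  then show ?thesis
    using assms by (simp add: cdiff_def mod_pos_pos_trivial)
next
  case False
  have "(int a - int b) mod (int n + 1) = (int a - int b + (int n + 1)) mod (int n + 1)"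
    by simp
  also have "\<dots> = int a - int b + (int n + 1)"
    using False assms by (intro mod_pos_pos_trivial) auto
  finally show ?thesis
    using False by (simp add: cdiff_def)
qed

lemma cdiff_inj: "\<lbrakk>a \<le> n; b \<le> n; c \<le> n; cdiff n a c = cdiff n b c\<rbrakk> \<Longrightarrow> a = b"
  by (simp add: cdiff_eq split: if_splits)

lemma cdiff_inj_right: "\<lbrakk>a \<le> n; b \<le> n; c \<le> n; cdiff n c a = cdiff n c b\<rbrakk> \<Longrightarrow> a = b"
  by (simp add: cdiff_eq split: if_splits)

lemma cyc_cross_iff:
  "cyc_cross n (i, j) (i', j') \<longleftrightarrow>
     (cdiff n j i' < cdiff n j i \<and> cdiff n j i' < cdiff n j' i') \<or>
     (cdiff n j' i < cdiff n j i \<and> cdiff n j' i < cdiff n j' i')"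
  by (simp add: cyc_cross_def)

text \<open>Going up cyclically from any \<open>i\<close>, the earlier of two neighbours is met
  first, since no element of \<open>I\<close> lies between them. If the two are the first and the
  last element, all of \<open>I\<close> lies between them and it is the last one that is met
  first.\<close>

lemma cyc_consecutive_imp_closer:
  assumes IJ: "I \<subseteq> {0..n}" "J \<subseteq> {0..n}"
    and cons: "cyc_consecutive (I <+> J) (Inr j) (Inr j')"
  obtains a b where "a \<in> J" "b \<in> J" "a \<noteq> b" "\<And>i. i \<in> I \<Longrightarrow> cdiff n a i < cdiff n b i"
proof -
  note result = that
  have 1: thesis if ab: "consecutive (I <+> J) (Inr a) (Inr b)" for a b
  proof -
    have *: "a \<in> J" "b \<in> J" "a < b"
      using ab by (auto simp: consecutive_def)
    have gap: "\<not> (a < i \<and> i \<le> b)" if "i \<in> I" for i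
      using ab that before.simps(2,3) unfolding consecutive_def by (metis InlI)
    have "cdiff n a i < cdiff n b i" if i: "i \<in> I" for i
    proof -
      have "a \<le> n" "b \<le> n" "i \<le> n"
        using * i IJ by auto
      then show ?thesis
        using *(3) gap[OF i] by (auto simp: cdiff_eq)
    qed
    then show thesis
      using * result[of a b] by blast
  qed
  have 2: thesis if ab: "first_and_last (I <+> J) (Inr a) (Inr b)" "a \<noteq> b" for a b
  proof -
    have *: "a \<in> J" "b \<in> J" "a < b" "\<And>i. i \<in> I \<Longrightarrow> a < i \<and> i \<le> b"
      using ab by (auto simp: first_and_last_def)
    have "cdiff n b i < cdiff n a i" if i: "i \<in> I" for i
    proof -
      have "a \<le> n" "b \<le> n" "i \<le> n"
        using * i IJ by auto
      then show ?thesis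
        using *(3) *(4)[OF i] by (auto simp: cdiff_eq)
    qed
    then show thesis
      using * result[of b a] by blast
  qed
  show thesis
    using cons 1 2 unfolding cyc_consecutive_def by blast
qed

lemma ex_argmin:
  fixes f :: "'a \<Rightarrow> int"
  assumes "finite X" "X \<noteq> {}"
  shows "\<exists>x\<in>X. \<forall>y\<in>X. f x \<le> f y"
proof -
  have "Min (f ` X) \<in> f ` X"
    using assms by (intro Min_in) auto
  then obtain x where x: "x \<in> X" "f x = Min (f ` X)"
    by auto
  have "f x \<le> f y" if "y \<in> X" for y
    unfolding x(2) using assms(1) that by simp
  then show ?thesis
    using x(1) by blast
qed

text \<open>\<open>b1\<close> and \<open>b2\<close> are the first two elements of \<open>J\<close>
  met when going up from \<open>i\<close>; \<open>c\<close> serves as the far end of a crossed arc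
  in \<open>cyc_consecutive_crossings\<close>.\<close>

lemma ex_first_two:
  assumes J: "J \<subseteq> {0..n}" "card J \<ge> 3" and i: "i \<le> n"
  obtains b1 b2 c where "b1 \<in> J" "b2 \<in> J" "c \<in> J" "cdiff n b1 i < cdiff n b2 i"
    "cdiff n b2 i < cdiff n c i" "\<And>b. b \<in> J \<Longrightarrow> cdiff n b1 i \<le> cdiff n b i"
    "\<And>b. b \<in> J \<Longrightarrow> b \<noteq> b1 \<Longrightarrow> cdiff n b2 i \<le> cdiff n b i"
proof -
  have fin: "finite J"
    using J(1) finite_subset by blast
  have less: "cdiff n a i < cdiff n b i" if "cdiff n a i \<le> cdiff n b i" "a \<noteq> b" "a \<in> J" "b \<in> J" for a b
    using that J(1) i cdiff_inj[of a n b i] by fastforce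
  have min: "\<exists>b\<in>X. \<forall>b'\<in>X. cdiff n b i \<le> cdiff n b' i" if "finite X" "X \<noteq> {}" for X
    by (rule ex_argmin[OF that])
  obtain b1 where b1: "b1 \<in> J" "\<And>b. b \<in> J \<Longrightarrow> cdiff n b1 i \<le> cdiff n b i"
    using min[OF fin] J(2) by fastforce
  have c1: "card (J - {b1}) \<ge> 2"
    using b1(1) J(2) fin by simp
  then have "J - {b1} \<noteq> {}"
    by force
  then obtain b2 where b2: "b2 \<in> J - {b1}" "\<And>b. b \<in> J - {b1} \<Longrightarrow> cdiff n b2 i \<le> cdiff n b i"
    using min[of "J - {b1}"] fin by blast
  have "card (J - {b1} - {b2}) \<ge> 1"
    using b2(1) c1 fin by simp
  then have "J - {b1} - {b2} \<noteq> {}"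
    by force
  then obtain c where c: "c \<in> J" "c \<noteq> b1" "c \<noteq> b2"
    by blast
  show thesis
    using that[of b1 b2 c] b1 b2 c less by blast
qed

text \<open>Let \<open>i0\<close> be the element of \<open>I\<close> nearest below \<open>b\<close>.
  Since \<open>a\<close> is met before \<open>b\<close>, the first two elements of \<open>J\<close>
  after \<open>i0\<close> come no later than \<open>b\<close>, so \<open>i0\<close> is the unique
  nearest element for both. Each crossing is then witnessed by a short arc at
  \<open>i0\<close>.\<close>

lemma cyc_consecutive_crossings:
  assumes IJ: "I \<subseteq> {0..n}" "J \<subseteq> {0..n}" and card: "card I \<ge> 2" "card J \<ge> 3"
    and cons: "cyc_consecutive (I <+> J) (Inr j) (Inr j')"
  obtains i0 i1 b1 b2 c where "i0 \<in> I" "i1 \<in> I" "b1 \<in> J" "b2 \<in> J" "c \<in> J"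
    "\<And>i. i \<in> I \<Longrightarrow> i \<noteq> i0 \<Longrightarrow> cyc_cross n (i, b2) (i0, c)" "cyc_cross n (i0, b2) (i1, b1)"
proof -
  obtain a b where ab: "a \<in> J" "b \<in> J" "a \<noteq> b" "\<And>i. i \<in> I \<Longrightarrow> cdiff n a i < cdiff n b i"
    using cyc_consecutive_imp_closer[OF IJ cons] by metis
  have fin: "finite I"
    using IJ(1) finite_subset by blast
  have le: "i \<le> n" if "i \<in> I" for i
    using that IJ by auto
  have le': "b \<le> n" if "b \<in> J" for b
    using that IJ by auto
  have "I \<noteq> {}"
    using card(1) by auto
  then obtain i0 where i0: "i0 \<in> I" "\<And>i. i \<in> I \<Longrightarrow> cdiff n b i0 \<le> cdiff n b i"
    using ex_argmin[OF fin, of "cdiff n b"] by blast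
  obtain i1 where i1: "i1 \<in> I" "i1 \<noteq> i0"
    using card(1) fin i0(1) by (metis card_le_Suc0_iff_eq not_less_eq_eq numeral_2_eq_2)
  obtain b1 b2 c where b: "b1 \<in> J" "b2 \<in> J" "c \<in> J" "cdiff n b1 i0 < cdiff n b2 i0"
    "cdiff n b2 i0 < cdiff n c i0" "\<And>b. b \<in> J \<Longrightarrow> cdiff n b1 i0 \<le> cdiff n b i0"
    "\<And>b. b \<in> J \<Longrightarrow> b \<noteq> b1 \<Longrightarrow> cdiff n b2 i0 \<le> cdiff n b i0"
    using ex_first_two[OF IJ(2) card(2) le[OF i0(1)]] by metis
  have "b \<noteq> b1"
    using ab(4)[OF i0(1)] b(6)[OF ab(1)] by auto
  then have b2: "cdiff n b2 i0 \<le> cdiff n b i0"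
    using b(7) ab(2) by blast
  \<comment> \<open>Moving the upper end back from \<open>b\<close> towards \<open>i0\<close> cannot
    bring another element of \<open>I\<close> nearer than \<open>i0\<close>.\<close>
  have nearer: "cdiff n v i0 < cdiff n v i"
    if v: "v \<in> J" "cdiff n v i0 \<le> cdiff n b i0" and i: "i \<in> I" "i \<noteq> i0" for v i
  proof -
    have "cdiff n b i0 \<noteq> cdiff n b i"
      using cdiff_inj_right[of i0 n i b] i i0(1) le le' ab(2) by blast
    then have "cdiff n b i0 < cdiff n b i"
      using i0(2)[OF i(1)] by simp
    then show ?thesis
      using v le[OF i(1)] le[OF i0(1)] le'[OF v(1)] le'[OF ab(2)]
      by (simp add: cdiff_eq split: if_splits)
  qed
  show thesis
  proof (rule that[OF i0(1) i1(1) b(1-3)])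
    show "cyc_cross n (i, b2) (i0, c)" if "i \<in> I" "i \<noteq> i0" for i
      using nearer[OF b(2) b2 that] b(5) by (simp add: cyc_cross_iff)
    show "cyc_cross n (i0, b2) (i1, b1)"
      using nearer[OF b(1) _ i1] b(4) b2 by (simp add: cyc_cross_iff)
  qed
qed

text \<open>The element \<open>z\<close> cyclically preceding \<open>j\<close> in the disjoint union
  is consecutive with \<open>j\<close>, so it cannot belong to \<open>J\<close>. As nothing lies
  between \<open>z\<close> and \<open>j\<close>, it is nearest to \<open>j\<close> within
  \<open>I\<close>, and \<open>j\<close> is the first element of \<open>J\<close> after it.\<close>

lemma ex_cyclic_predecessor:
  assumes IJ: "I \<subseteq> {0..n}" "J \<subseteq> {0..n}" and card: "card J \<ge> 2" and j: "j \<in> J"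
    and ncons: "\<And>j'. j' \<in> J \<Longrightarrow> \<not> cyc_consecutive (I <+> J) (Inr j') (Inr j)"
  obtains i where "i \<in> I" "\<And>i'. i' \<in> I \<Longrightarrow> cdiff n j i \<le> cdiff n j i'"
    "\<And>b. b \<in> J \<Longrightarrow> cdiff n j i \<le> cdiff n b i"
proof -
  \<comment> \<open>Even numbers for \<open>I\<close>, odd ones for \<open>J\<close>: the
    interleaved order becomes the order of \<open>nat\<close>.\<close>
  define key where "key = case_sum (\<lambda>a. 2 * a) (\<lambda>a. 2 * a + (1::nat))"
  have before: "before x y \<longleftrightarrow> key x < key y" for x y
    by (cases x; cases y) (auto simp: key_def)
  have key: "key (Inl a) = 2 * a" "key (Inr a) = 2 * a + 1" for a
    by (simp_all add: key_def)
  have key_inj: "x = y" if "key x = key y" for x y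
    using that by (cases x; cases y) (simp_all add: key, presburger+)
  let ?S = "I <+> J"
  have fin: "finite ?S"
    using IJ by (simp add: finite_subset finite_Plus)
  have max: "\<exists>z\<in>X. \<forall>y\<in>X. key y \<le> key z" if "X \<noteq> {}" "X \<subseteq> ?S" for X
    using ex_argmin[OF finite_subset[OF that(2) fin] that(1), of "\<lambda>x. - int (key x)"] by auto
  have le: "i \<le> n" if "i \<in> I" for i
    using that IJ by auto
  have le': "b \<le> n" if "b \<in> J" for b
    using that IJ by auto
  show thesis
  proof (cases "\<exists>z\<in>?S. key z < key (Inr j)")
    case True
    then obtain z where z: "z \<in> ?S" "key z < key (Inr j)"
      and zmax: "\<And>y. \<lbrakk>y \<in> ?S; key y < key (Inr j)\<rbrakk> \<Longrightarrow> key y \<le> key z"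
      using max[of "{z \<in> ?S. key z < key (Inr j)}"] by auto
    have "consecutive ?S z (Inr j)"
      unfolding consecutive_def before using z zmax j by force
    then have cc: "cyc_consecutive ?S z (Inr j)"
      using z(2) by (auto simp: cyc_consecutive_def)
    obtain i where i: "z = Inl i" "i \<in> I"
      using z(1) cc ncons by auto
    have ij: "i \<le> j"
      using z(2) by (simp add: i key)
    have I': "i' \<le> i \<or> j < i'" if "i' \<in> I" for i'
      using zmax[OF InlI[OF that]] by (auto simp: i key)
    have J': "b < i \<or> j \<le> b" if "b \<in> J" for b
      using zmax[OF InrI[OF that]] by (auto simp: i key)
    show thesis
    proof (rule that[OF i(2)])
      show "cdiff n j i \<le> cdiff n j i'" if "i' \<in> I" for i'
        using ij I'[OF that] le[OF that] le[OF i(2)] le'[OF j] by (auto simp: cdiff_eq)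
      show "cdiff n j i \<le> cdiff n b i" if "b \<in> J" for b
        using ij J'[OF that] le'[OF that] le[OF i(2)] le'[OF j] by (auto simp: cdiff_eq)
    qed
  next
    \<comment> \<open>Now \<open>j\<close> is the first element, so the cyclically preceding one is
      the last.\<close>
    case False
    then have first: "key (Inr j) \<le> key z" if "z \<in> ?S" for z
      using that by (meson not_less)
    obtain z where z: "z \<in> ?S" and zmax: "\<And>y. y \<in> ?S \<Longrightarrow> key y \<le> key z"
      using max[of ?S] j by blast
    obtain j' where j': "j' \<in> J" "j' \<noteq> j"
      using card j by (metis card_le_Suc0_iff_eq card.infinite not_less_eq_eq numeral_2_eq_2 zero_le)
    have "z \<noteq> Inr j"
      using first[OF InrI[OF j'(1)]] zmax[OF InrI[OF j'(1)]] j' by (auto simp: key)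
    moreover have "first_and_last ?S (Inr j) z"
      unfolding first_and_last_def before
      using z j first zmax by (auto simp: order_less_le dest: key_inj)
    ultimately have cc: "cyc_consecutive ?S z (Inr j)"
      by (auto simp: cyc_consecutive_def)
    obtain i where i: "z = Inl i" "i \<in> I"
      using z(1) cc ncons by auto
    have I': "i' \<le> i" "j < i'" if "i' \<in> I" for i'
      using zmax[OF InlI[OF that]] first[OF InlI[OF that]] by (auto simp: i key)
    have J': "b < i" "j \<le> b" if "b \<in> J" for b
      using zmax[OF InrI[OF that]] first[OF InrI[OF that]] by (auto simp: i key)
    show thesis
    proof (rule that[OF i(2)])
      show "cdiff n j i \<le> cdiff n j i'" if "i' \<in> I" for i'
        using I'[OF that] I'[OF i(2)] le[OF that] le[OF i(2)] le'[OF j] by (auto simp: cdiff_eq)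
      show "cdiff n j i \<le> cdiff n b i" if "b \<in> J" for b
        using J'[OF that] I'[OF i(2)] le'[OF that] le[OF i(2)] le'[OF j] by (auto simp: cdiff_eq)
    qed
  qed
qed

section \<open>Centrally symmetric dissections\<close>

text \<open>
  An arc \<open>(k, l)\<close> of cyclic length \<open>\<delta> = l - k\<close> modulo \<open>d + 1\<close> corresponds to the orbit of the diagonal
  \<open>{k, k + \<delta> + 1}\<close> under the central symmetry; \<open>arc_of_ends d u v\<close> is the inverse map for \<open>u < v\<close>.
\<close>

definition arc_of_ends :: "nat \<Rightarrow> nat \<Rightarrow> nat \<Rightarrow> nat \<times> nat" where
  "arc_of_ends d u v =
     (if v \<le> u + d + 1 then (if u \<le> d then u else u - (d + 1), if v \<le> d + 1 then v - 1 else v - 1 - (d + 1))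
      else (v - (d + 1), if u = 0 then d else u - 1))"

definition arc_of_diagonal :: "nat \<Rightarrow> nat set \<Rightarrow> nat \<times> nat" where
  "arc_of_diagonal d E = arc_of_ends d (Min E) (Max E)"

definition rotate_diagonal :: "nat \<Rightarrow> nat set \<Rightarrow> nat set" where
  "rotate_diagonal d E = (\<lambda>v. (v + d + 1) mod (2 * d + 2)) ` E"

text \<open>The excluded arcs \<open>(k, k)\<close> have cyclic length 0 and would correspond to
  sides \<open>{k, k + 1}\<close> of the polygon.\<close>

definition proper_arcs :: "nat \<Rightarrow> (nat \<times> nat) set" where
  "proper_arcs d = {(k, l). k \<le> d \<and> l \<le> d \<and> k \<noteq> l}"

lemma arc_of_diagonal_ends: "u < v \<Longrightarrow> arc_of_diagonal d {u, v} = arc_of_ends d u v"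
  by (simp add: arc_of_diagonal_def min_def max_def)

text \<open>A normal form with increasing ends; the last bound excludes just the side
  \<open>{0, 2 * d + 1}\<close>.\<close>

lemma diagonalE:
  assumes "E \<in> diagonals (2 * d + 2)"
  obtains u v where "E = {u, v}" "u + 2 \<le> v" "v < 2 * d + 2" "v \<le> u + 2 * d"
proof -
  obtain a b where ab: "E = {a, b}" "a < 2 * d + 2" "b < 2 * d + 2" "a \<noteq> b"
    "(a + 1) mod (2 * d + 2) \<noteq> b" "(b + 1) mod (2 * d + 2) \<noteq> a"
    using assms by (auto simp: diagonals_def)
  have *: thesis if E: "E = {x, y}" "x < y" "y < 2 * d + 2" "(x + 1) mod (2 * d + 2) \<noteq> y"
    "(y + 1) mod (2 * d + 2) \<noteq> x" for x y
  proof -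
    have "x + 1 \<noteq> y"
      using E by auto
    moreover have "\<not> (x = 0 \<and> y = 2 * d + 1)"
      using E(5) by auto
    ultimately show thesis
      using E(1-3) by (intro \<open>\<And>u v. \<lbrakk>E = {u, v}; u + 2 \<le> v; v < 2 * d + 2; v \<le> u + 2 * d\<rbrakk> \<Longrightarrow> thesis\<close>[of x y]) auto
  qed
  show thesis
    using *[of a b] *[of b a] ab by (cases "a < b") (auto simp: insert_commute)
qed

lemma diagonalI:
  assumes "u + 2 \<le> v" "v < 2 * d + 2" "v \<le> u + 2 * d"
  shows "{u, v} \<in> diagonals (2 * d + 2)"
proof -
  have "(u + 1) mod (2 * d + 2) \<noteq> v"
    using assms by simp
  moreover have "(v + 1) mod (2 * d + 2) \<noteq> u"
    using assms by (cases "v + 1 = 2 * d + 2") auto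
  ultimately show ?thesis
    unfolding diagonals_def using assms by fastforce
qed

lemma diagonals_cross_ends:
  assumes "u < v" "u' < v'"
  shows "diagonals_cross {u, v} {u', v'} \<longleftrightarrow> u < u' \<and> u' < v \<and> v < v' \<or> u' < u \<and> u < v' \<and> v' < v"
proof
  assume "diagonals_cross {u, v} {u', v'}"
  then show "u < u' \<and> u' < v \<and> v < v' \<or> u' < u \<and> u < v' \<and> v' < v"
    using assms unfolding diagonals_cross_def doubleton_eq_iff by fastforce
next
  assume "u < u' \<and> u' < v \<and> v < v' \<or> u' < u \<and> u < v' \<and> v' < v"
  then show "diagonals_cross {u, v} {u', v'}"
    unfolding diagonals_cross_def by blast
qed

text \<open>The half turn adds \<open>d + 1\<close> to labels up to \<open>d\<close> and subtracts
  it from the larger ones. It reverses the order of the ends only when they lie in different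
  halves.\<close>

lemma rotate_diagonal_ends:
  assumes "u < v" "v < 2 * d + 2"
  shows "rotate_diagonal d {u, v} =
    (if v \<le> d then {u + (d + 1), v + (d + 1)}
     else if u \<le> d then {v - (d + 1), u + (d + 1)} else {u - (d + 1), v - (d + 1)})"
proof -
  have "(x + d + 1) mod (2 * d + 2) = (if x \<le> d then x + (d + 1) else x - (d + 1))" if "x < 2 * d + 2" for x
  proof (cases "x \<le> d")
    case False
    then have "x + d + 1 = x - (d + 1) + (2 * d + 2)"
      by simp
    then have "(x + d + 1) mod (2 * d + 2) = (x - (d + 1) + (2 * d + 2)) mod (2 * d + 2)"
      by (rule arg_cong)
    also have "\<dots> = x - (d + 1)"
      using that by (subst mod_add_self2) simp
    finally show ?thesis
      using False by simp
  qed simp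
  then show ?thesis
    using assms by (auto simp: rotate_diagonal_def)
qed

lemma rotate_diagonal_in:
  assumes "E \<in> diagonals (2 * d + 2)"
  shows "rotate_diagonal d E \<in> diagonals (2 * d + 2)"
  using assms
proof (rule diagonalE)
  fix u v assume *: "E = {u, v}" "u + 2 \<le> v" "v < 2 * d + 2" "v \<le> u + 2 * d"
  then show ?thesis
  proof -
    have "u < v"
      using *(2) by simp
    show ?thesis
      unfolding *(1) rotate_diagonal_ends[OF \<open>u < v\<close> *(3)] using *(2-4)
      by (cases "v \<le> d"; cases "u \<le> d") (simp_all only: if_True if_False, auto intro!: diagonalI
          simp del: add_2_eq_Suc' mult_Suc_right One_nat_def add_Suc_right)
  qed
qed

lemma arc_of_ends_proper:
  assumes "u + 2 \<le> v" "v < 2 * d + 2" "v \<le> u + 2 * d"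
  shows "arc_of_ends d u v \<in> proper_arcs d"
  using assms by (auto simp: arc_of_ends_def proper_arcs_def)

text \<open>Over the integers, so that no truncated subtraction occurs.\<close>

definition ends_arc :: "int \<Rightarrow> int \<Rightarrow> int \<Rightarrow> int \<Rightarrow> int \<Rightarrow> bool" where
  "ends_arc d u v k l \<longleftrightarrow> 0 \<le> u \<and> u + 2 \<le> v \<and> v < 2 * d + 2 \<and> v \<le> u + 2 * d \<and>
    (u \<le> d \<and> v \<le> d + 1 \<and> k = u \<and> l = v - 1 \<or>
     u \<le> d \<and> d + 2 \<le> v \<and> v \<le> u + d + 1 \<and> k = u \<and> l = v - d - 2 \<or>
     d + 1 \<le> u \<and> k = u - d - 1 \<and> l = v - d - 2 \<or>
     u + d + 1 < v \<and> 1 \<le> u \<and> k = v - d - 1 \<and> l = u - 1 \<or>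
     d + 1 < v \<and> u = 0 \<and> k = v - d - 1 \<and> l = d)"

definition int_cdiff :: "int \<Rightarrow> int \<Rightarrow> int \<Rightarrow> int" where
  "int_cdiff d a b = (if b \<le> a then a - b else a - b + d + 1)"

definition int_cross :: "int \<Rightarrow> int \<Rightarrow> int \<Rightarrow> int \<Rightarrow> int \<Rightarrow> bool" where
  "int_cross d k l k' l' \<longleftrightarrow>
    int_cdiff d l k' < int_cdiff d l k \<and> int_cdiff d l k' < int_cdiff d l' k' \<or>
    int_cdiff d l' k < int_cdiff d l k \<and> int_cdiff d l' k < int_cdiff d l' k'"

definition ends_cross :: "int \<Rightarrow> int \<Rightarrow> int \<Rightarrow> int \<Rightarrow> bool" where
  "ends_cross u v u' v' \<longleftrightarrow> u < u' \<and> u' < v \<and> v < v' \<or> u' < u \<and> u < v' \<and> v' < v"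

lemma cyc_cross_int:
  assumes "k \<le> d" "l \<le> d" "k' \<le> d" "l' \<le> d"
  shows "cyc_cross d (k, l) (k', l') \<longleftrightarrow> int_cross (int d) (int k) (int l) (int k') (int l')"
  using assms by (simp add: cyc_cross_iff cdiff_eq int_cross_def int_cdiff_def)

text \<open>The fibres are the orbits of the half turn: the last three disjuncts are the three
  shapes in \<open>rotate_diagonal_ends\<close>.\<close>

lemma ends_arc_eq_iff:
  assumes "ends_arc d u v k l" "ends_arc d u' v' k' l'"
  shows "k = k' \<and> l = l' \<longleftrightarrow> u = u' \<and> v = v' \<or> u' = u + d + 1 \<and> v' = v + d + 1 \<or>
    v = u' + d + 1 \<and> v' = u + d + 1 \<or> u = u' + d + 1 \<and> v = v' + d + 1"
  using assms unfolding ends_arc_def by (smt (z3))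

lemma ends_cross_imp_int_cross:
  assumes "ends_arc d u v k l" "ends_arc d u' v' k' l'" "ends_cross u v u' v'"
  shows "int_cross d k l k' l'"
  using assms unfolding ends_arc_def ends_cross_def int_cross_def int_cdiff_def by (smt (z3))

text \<open>An arc does not tell which diagonal of its orbit is meant, so the crossing may show only
  after the second diagonal is rotated; the three branches list its rotated ends in increasing
  order.\<close>

lemma int_cross_imp_ends_cross:
  assumes "ends_arc d u v k l" "ends_arc d u' v' k' l'" "int_cross d k l k' l'"
  shows "ends_cross u v u' v' \<or>
    (if v' \<le> d then ends_cross u v (u' + d + 1) (v' + d + 1)
     else if u' \<le> d then ends_cross u v (v' - d - 1) (u' + d + 1)
     else ends_cross u v (u' - d - 1) (v' - d - 1))"
  using assms unfolding ends_arc_def ends_cross_def int_cross_def int_cdiff_def by (smt (z3))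

lemma ends_arc_of_ends:
  assumes "u + 2 \<le> v" "v < 2 * d + 2" "v \<le> u + 2 * d" and "arc_of_ends d u v = (k, l)"
  shows "ends_arc (int d) (int u) (int v) (int k) (int l)"
proof -
  consider "v \<le> u + d + 1" "u \<le> d" "v \<le> d + 1" | "v \<le> u + d + 1" "u \<le> d" "\<not> v \<le> d + 1"
    | "v \<le> u + d + 1" "\<not> u \<le> d" | "\<not> v \<le> u + d + 1" "u \<noteq> 0" | "\<not> v \<le> u + d + 1" "u = 0"
    by blast
  then show ?thesis
  proof cases
    case 1
    then have "k = u" "l + 1 = v"
      using assms by (auto simp: arc_of_ends_def)
    then show ?thesis
      using 1 assms(1-3) unfolding ends_arc_def by auto
  next
    case 2
    then have "k = u" "l + d + 2 = v"
      using assms by (auto simp: arc_of_ends_def)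
    then show ?thesis
      using 2 assms(1-3) unfolding ends_arc_def by auto
  next
    case 3
    then have "k + d + 1 = u" "l + d + 2 = v"
      using assms by (auto simp: arc_of_ends_def)
    then show ?thesis
      using 3 assms(1-3) unfolding ends_arc_def by auto
  next
    case 4
    then have "k + d + 1 = v" "l + 1 = u"
      using assms by (auto simp: arc_of_ends_def)
    then show ?thesis
      using 4 assms(1-3) unfolding ends_arc_def by auto
  next
    case 5
    then have "k + d + 1 = v" "l = d"
      using assms by (auto simp: arc_of_ends_def)
    then show ?thesis
      using 5 assms(1-3) unfolding ends_arc_def by auto
  qed
qed

lemma arc_of_diagonal_proper: "E \<in> diagonals (2 * d + 2) \<Longrightarrow> arc_of_diagonal d E \<in> proper_arcs d"
  by (erule diagonalE) (simp add: arc_of_diagonal_ends arc_of_ends_proper)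

lemma arc_of_diagonal_surj:
  assumes "p \<in> proper_arcs d"
  obtains E where "E \<in> diagonals (2 * d + 2)" "arc_of_diagonal d E = p"
proof -
  obtain k l where p: "p = (k, l)" "k \<le> d" "l \<le> d" "k \<noteq> l"
    using assms by (auto simp: proper_arcs_def)
  \<comment> \<open>The end \<open>k + \<delta> + 1\<close>, where the cyclic length
    \<open>\<delta>\<close> from \<open>k\<close> to \<open>l\<close> wraps around if
    \<open>l < k\<close>.\<close>
  define v where "v = (if k < l then l + 1 else l + d + 2)"
  have v: "k + 2 \<le> v" "v < 2 * d + 2" "v \<le> k + 2 * d" "v \<le> k + d + 1"
    using p by (auto simp: v_def)
  have "arc_of_diagonal d {k, v} = p"
    using v p by (auto simp: arc_of_diagonal_ends arc_of_ends_def v_def)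
  then show ?thesis
    using that diagonalI[OF v(1-3)] by blast
qed

lemma arc_of_ends_eq_iff:
  assumes "u + 2 \<le> v" "v < 2 * d + 2" "v \<le> u + 2 * d" "u' + 2 \<le> v'" "v' < 2 * d + 2" "v' \<le> u' + 2 * d"
  shows "arc_of_ends d u v = arc_of_ends d u' v' \<longleftrightarrow>
    u = u' \<and> v = v' \<or> u' = u + (d + 1) \<and> v' = v + (d + 1) \<or>
    v = u' + (d + 1) \<and> v' = u + (d + 1) \<or> u = u' + (d + 1) \<and> v = v' + (d + 1)"
proof -
  obtain k l k' l' where kl: "arc_of_ends d u v = (k, l)" "arc_of_ends d u' v' = (k', l')"
    by (metis surj_pair)
  have int_iff: "a = b + (d + 1) \<longleftrightarrow> int a = int b + int d + 1" for a b
    by linarith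
  show ?thesis
    unfolding kl prod.inject int_iff
    using ends_arc_eq_iff[OF ends_arc_of_ends[OF assms(1-3) kl(1)] ends_arc_of_ends[OF assms(4-6) kl(2)]]
    by (simp only: of_nat_eq_iff)
qed

lemma arc_of_diagonal_eq_iff:
  assumes "E \<in> diagonals (2 * d + 2)" "E' \<in> diagonals (2 * d + 2)"
  shows "arc_of_diagonal d E = arc_of_diagonal d E' \<longleftrightarrow> E' = E \<or> E' = rotate_diagonal d E"
proof -
  obtain u v where E: "E = {u, v}" "u + 2 \<le> v" "v < 2 * d + 2" "v \<le> u + 2 * d"
    using assms(1) by (rule diagonalE)
  obtain u' v' where E': "E' = {u', v'}" "u' + 2 \<le> v'" "v' < 2 * d + 2" "v' \<le> u' + 2 * d"
    using assms(2) by (rule diagonalE)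
  have lt: "u < v" "u' < v'"
    using E E' by auto
  have ordered: "{u', v'} = {a, b} \<longleftrightarrow> u' = a \<and> v' = b" if "a < b" for a b
    using that lt by (auto simp: doubleton_eq_iff)
  have "E' = rotate_diagonal d E \<longleftrightarrow> u' = u + (d + 1) \<and> v' = v + (d + 1) \<or>
    v = u' + (d + 1) \<and> v' = u + (d + 1) \<or> u = u' + (d + 1) \<and> v = v' + (d + 1)"
  proof -
    consider "v \<le> d" | "\<not> v \<le> d" "u \<le> d" | "\<not> v \<le> d" "\<not> u \<le> d"
      by blast
    then show ?thesis
    proof cases
      case 1
      then have "E' = rotate_diagonal d E \<longleftrightarrow> u' = u + (d + 1) \<and> v' = v + (d + 1)"
        unfolding E(1) E'(1) rotate_diagonal_ends[OF lt(1) E(3)] using lt by (simp add: ordered)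
      then show ?thesis
        using 1 lt by linarith
    next
      case 2
      have "v - (d + 1) < u + (d + 1)"
        using 2 E by linarith
      then have "E' = rotate_diagonal d E \<longleftrightarrow> u' = v - (d + 1) \<and> v' = u + (d + 1)"
        unfolding E(1) E'(1) rotate_diagonal_ends[OF lt(1) E(3)] using 2 by (simp add: ordered)
      then show ?thesis
        using 2 E'(3) by linarith
    next
      case 3
      have "u - (d + 1) < v - (d + 1)"
        using 3 lt by linarith
      then have "E' = rotate_diagonal d E \<longleftrightarrow> u' = u - (d + 1) \<and> v' = v - (d + 1)"
        unfolding E(1) E'(1) rotate_diagonal_ends[OF lt(1) E(3)] using 3 by (simp add: ordered)
      then show ?thesis
        using 3 lt E'(3) by linarith
    qed
  qed
  moreover have "E' = E \<longleftrightarrow> u = u' \<and> v = v'"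
    unfolding E(1) E'(1) using ordered[OF lt(1)] by auto
  ultimately show ?thesis
    unfolding E(1) E'(1) arc_of_diagonal_ends[OF lt(1)] arc_of_diagonal_ends[OF lt(2)]
      arc_of_ends_eq_iff[OF E(2-4) E'(2-4)] by blast
qed

lemma diagonals_cross_arcs:
  assumes "E \<in> diagonals (2 * d + 2)" "E' \<in> diagonals (2 * d + 2)" "diagonals_cross E E'"
  shows "cyc_cross d (arc_of_diagonal d E) (arc_of_diagonal d E')"
proof -
  obtain u v where E: "E = {u, v}" "u + 2 \<le> v" "v < 2 * d + 2" "v \<le> u + 2 * d"
    using assms(1) by (rule diagonalE)
  obtain u' v' where E': "E' = {u', v'}" "u' + 2 \<le> v'" "v' < 2 * d + 2" "v' \<le> u' + 2 * d"
    using assms(2) by (rule diagonalE)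
  have lt: "u < v" "u' < v'"
    using E E' by auto
  obtain k l k' l' where kl: "arc_of_ends d u v = (k, l)" "arc_of_ends d u' v' = (k', l')"
    by (metis surj_pair)
  have "arc_of_ends d u v \<in> proper_arcs d" "arc_of_ends d u' v' \<in> proper_arcs d"
    using E E' by (auto intro: arc_of_ends_proper)
  then have le: "k \<le> d" "l \<le> d" "k' \<le> d" "l' \<le> d"
    by (auto simp: kl proper_arcs_def)
  have arcs: "arc_of_diagonal d E = (k, l)" "arc_of_diagonal d E' = (k', l')"
    using E(1) E'(1) lt kl by (simp_all add: arc_of_diagonal_ends)
  note ends = ends_arc_of_ends[OF E(2-4) kl(1)] ends_arc_of_ends[OF E'(2-4) kl(2)]
  have "ends_cross (int u) (int v) (int u') (int v')"
    using assms(3) lt by (simp add: E(1) E'(1) diagonals_cross_ends ends_cross_def)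
  then show ?thesis
    unfolding arcs cyc_cross_int[OF le] by (rule ends_cross_imp_int_cross[OF ends])
qed

lemma arcs_cross_diagonals:
  assumes "E \<in> diagonals (2 * d + 2)" "E' \<in> diagonals (2 * d + 2)"
    "cyc_cross d (arc_of_diagonal d E) (arc_of_diagonal d E')"
  shows "diagonals_cross E E' \<or> diagonals_cross E (rotate_diagonal d E')"
proof -
  obtain u v where E: "E = {u, v}" "u + 2 \<le> v" "v < 2 * d + 2" "v \<le> u + 2 * d"
    using assms(1) by (rule diagonalE)
  obtain u' v' where E': "E' = {u', v'}" "u' + 2 \<le> v'" "v' < 2 * d + 2" "v' \<le> u' + 2 * d"
    using assms(2) by (rule diagonalE)
  have lt: "u < v" "u' < v'"
    using E E' by auto
  obtain k l k' l' where kl: "arc_of_ends d u v = (k, l)" "arc_of_ends d u' v' = (k', l')"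
    by (metis surj_pair)
  have "arc_of_ends d u v \<in> proper_arcs d" "arc_of_ends d u' v' \<in> proper_arcs d"
    using E E' by (auto intro: arc_of_ends_proper)
  then have le: "k \<le> d" "l \<le> d" "k' \<le> d" "l' \<le> d"
    by (auto simp: kl proper_arcs_def)
  have arcs: "arc_of_diagonal d E = (k, l)" "arc_of_diagonal d E' = (k', l')"
    using E(1) E'(1) lt kl by (simp_all add: arc_of_diagonal_ends)
  note ends = ends_arc_of_ends[OF E(2-4) kl(1)] ends_arc_of_ends[OF E'(2-4) kl(2)]
  have cross: "ends_cross (int u) (int v) (int a) (int b) \<Longrightarrow> diagonals_cross E {a, b}" if "a < b" for a b
    using that lt by (simp add: E(1) diagonals_cross_ends ends_cross_def)
  have rot: "rotate_diagonal d E' = (if v' \<le> d then {u' + (d + 1), v' + (d + 1)}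
     else if u' \<le> d then {v' - (d + 1), u' + (d + 1)} else {u' - (d + 1), v' - (d + 1)})"
    unfolding E'(1) by (rule rotate_diagonal_ends[OF lt(2) E'(3)])
  have "int_cross (int d) (int k) (int l) (int k') (int l')"
    using assms(3) unfolding arcs cyc_cross_int[OF le] .
  from int_cross_imp_ends_cross[OF ends this] consider
      "ends_cross (int u) (int v) (int u') (int v')"
    | "v' \<le> d" "ends_cross (int u) (int v) (int (u' + (d + 1))) (int (v' + (d + 1)))"
    | "\<not> v' \<le> d" "u' \<le> d" "ends_cross (int u) (int v) (int (v' - (d + 1))) (int (u' + (d + 1)))"
    | "\<not> v' \<le> d" "\<not> u' \<le> d" "ends_cross (int u) (int v) (int (u' - (d + 1))) (int (v' - (d + 1)))"
    by (auto simp: of_nat_diff algebra_simps split: if_splits)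
  then show ?thesis
  proof cases
    case 1
    then show ?thesis using cross[OF lt(2)] E'(1) by simp
  next
    case 2
    then show ?thesis using cross[of "u' + (d + 1)" "v' + (d + 1)"] lt(2) rot by simp
  next
    case 3
    then show ?thesis using cross[of "v' - (d + 1)" "u' + (d + 1)"] E' rot by simp
  next
    case 4
    then show ?thesis using cross[of "u' - (d + 1)" "v' - (d + 1)"] lt(2) rot by simp
  qed
qed

section \<open>Dissections as preimages of arc sets\<close>

definition dissection_of_arcs :: "nat \<Rightarrow> (nat \<times> nat) set \<Rightarrow> nat set set" where
  "dissection_of_arcs d T = {E \<in> diagonals (2 * d + 2). arc_of_diagonal d E \<in> T}"

lemma dissection_of_arcs_subset_iff:
  assumes "T \<subseteq> proper_arcs d"
  shows "dissection_of_arcs d T \<subseteq> dissection_of_arcs d T' \<longleftrightarrow> T \<subseteq> T'"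
proof
  assume sub: "dissection_of_arcs d T \<subseteq> dissection_of_arcs d T'"
  show "T \<subseteq> T'"
  proof
    fix p assume p: "p \<in> T"
    obtain E where E: "E \<in> diagonals (2 * d + 2)" "arc_of_diagonal d E = p"
      using arc_of_diagonal_surj[of p d] p assms by blast
    then have "E \<in> dissection_of_arcs d T'"
      using p sub by (auto simp: dissection_of_arcs_def)
    then show "p \<in> T'"
      using E by (simp add: dissection_of_arcs_def)
  qed
qed (auto simp: dissection_of_arcs_def)

lemma rotate_diagonal_rotate:
  assumes "E \<in> diagonals (2 * d + 2)"
  shows "rotate_diagonal d (rotate_diagonal d E) = E"
proof -
  obtain u v where E: "E = {u, v}" "u + 2 \<le> v" "v < 2 * d + 2" "v \<le> u + 2 * d"
    using assms by (rule diagonalE)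
  show ?thesis
    using E(2-4) unfolding E(1)
    by (auto simp: rotate_diagonal_ends)
qed

text \<open>A centrally symmetric set of diagonals is a union of orbits, hence the full preimage of
  its arcs. Its invariance also absorbs the rotation in \<open>arcs_cross_diagonals\<close>, so
  noncrossing means the same on both sides.\<close>

lemma symmetric_dissections_eq:
  "symmetric_dissections d = dissection_of_arcs d `
     {T. T \<subseteq> proper_arcs d \<and> (\<forall>p\<in>T. \<forall>q\<in>T. \<not> cyc_cross d p q)}"
proof (intro set_eqI iffI)
  fix X assume "X \<in> symmetric_dissections d"
  then have X: "X \<subseteq> diagonals (2 * d + 2)" "\<And>D E. \<lbrakk>D \<in> X; E \<in> X\<rbrakk> \<Longrightarrow> \<not> diagonals_cross D E"
    "rotate_diagonal d ` X = X"
    by (auto simp: symmetric_dissections_def rotate_diagonal_def)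
  define T where "T = arc_of_diagonal d ` X"
  have rot: "rotate_diagonal d E \<in> X" if "E \<in> X" for E
    using X(3) that by blast
  have "T \<subseteq> proper_arcs d"
    using X(1) arc_of_diagonal_proper by (auto simp: T_def)
  moreover have "\<not> cyc_cross d p q" if pq: "p \<in> T" "q \<in> T" for p q
  proof -
    obtain E E' where E: "E \<in> X" "p = arc_of_diagonal d E" "E' \<in> X" "q = arc_of_diagonal d E'"
      using pq by (auto simp: T_def)
    then show ?thesis
      using arcs_cross_diagonals[of E d E'] X(1) X(2)[OF E(1,3)] X(2)[OF E(1) rot[OF E(3)]] by blast
  qed
  moreover have "X = dissection_of_arcs d T"
  proof (intro set_eqI iffI)
    fix E assume "E \<in> dissection_of_arcs d T"
    then obtain E' where E: "E \<in> diagonals (2 * d + 2)" "E' \<in> X" "arc_of_diagonal d E' = arc_of_diagonal d E"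
      by (force simp: dissection_of_arcs_def T_def)
    then have "E = E' \<or> E = rotate_diagonal d E'"
      using arc_of_diagonal_eq_iff[of E' d E] X(1) by blast
    then show "E \<in> X"
      using E(2) rot by blast
  qed (use X(1) in \<open>auto simp: dissection_of_arcs_def T_def\<close>)
  ultimately show "X \<in> dissection_of_arcs d ` {T. T \<subseteq> proper_arcs d \<and> (\<forall>p\<in>T. \<forall>q\<in>T. \<not> cyc_cross d p q)}"
    by blast
next
  fix X assume "X \<in> dissection_of_arcs d ` {T. T \<subseteq> proper_arcs d \<and> (\<forall>p\<in>T. \<forall>q\<in>T. \<not> cyc_cross d p q)}"
  then obtain T where T: "X = dissection_of_arcs d T" "\<And>p q. p \<in> T \<Longrightarrow> q \<in> T \<Longrightarrow> \<not> cyc_cross d p q"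
    by auto
  have rot: "rotate_diagonal d E \<in> X" if "E \<in> X" for E
    using that rotate_diagonal_in[of E d] arc_of_diagonal_eq_iff[of E d "rotate_diagonal d E"]
    by (auto simp: T(1) dissection_of_arcs_def)
  have "rotate_diagonal d ` X = X"
  proof
    show "X \<subseteq> rotate_diagonal d ` X"
    proof
      fix E assume E: "E \<in> X"
      then have "E = rotate_diagonal d (rotate_diagonal d E)"
        by (intro rotate_diagonal_rotate[symmetric]) (simp add: T(1) dissection_of_arcs_def)
      then show "E \<in> rotate_diagonal d ` X"
        using rot[OF E] by blast
    qed
  qed (use rot in blast)
  moreover have "\<not> diagonals_cross E E'" if "E \<in> X" "E' \<in> X" for E E'
    using that T(2) diagonals_cross_arcs[of E d E'] by (auto simp: T(1) dissection_of_arcs_def)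
  ultimately show "X \<in> symmetric_dissections d"
    by (auto simp: symmetric_dissections_def T(1) dissection_of_arcs_def rotate_diagonal_def)
qed

section \<open>Cuts of noncrossing sets of arcs\<close>

lemma int_cdiff_eq: "\<lbrakk>a \<le> d; b \<le> d\<rbrakk> \<Longrightarrow> cdiff d a b = int_cdiff (int d) (int a) (int b)"
  by (simp add: cdiff_eq int_cdiff_def)

text \<open>Relabels \<open>J\<close> increasingly by an initial segment of the naturals when
  \<open>\<kappa>\<close> is injective, so that arcs become arcs of a polygon whose size depends on
  \<open>J\<close> alone.\<close>

definition label_rank :: "('j::finite \<Rightarrow> nat) \<Rightarrow> 'j \<Rightarrow> nat" where
  "label_rank \<kappa> b = card {c. \<kappa> c < \<kappa> b}"

lemma label_rank_less_iff:
  fixes \<kappa> :: "'j::finite \<Rightarrow> nat"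
  shows "label_rank \<kappa> a < label_rank \<kappa> b \<longleftrightarrow> \<kappa> a < \<kappa> b"
proof
  assume "\<kappa> a < \<kappa> b"
  then show "label_rank \<kappa> a < label_rank \<kappa> b"
    unfolding label_rank_def by (intro psubset_card_mono) auto
next
  assume "label_rank \<kappa> a < label_rank \<kappa> b"
  then show "\<kappa> a < \<kappa> b"
  proof (rule contrapos_pp)
    assume "\<not> \<kappa> a < \<kappa> b"
    then have "label_rank \<kappa> b \<le> label_rank \<kappa> a"
      unfolding label_rank_def by (intro card_mono) auto
    then show "\<not> label_rank \<kappa> a < label_rank \<kappa> b"
      by simp
  qed
qed

lemma label_rank_le: "label_rank \<kappa> b \<le> CARD('j) - 1" for \<kappa> :: "'j::finite \<Rightarrow> nat"
proof -
  have "label_rank \<kappa> b < card (UNIV :: 'j set)"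
    unfolding label_rank_def by (intro psubset_card_mono) auto
  then show ?thesis by simp
qed

lemma inj_label_rank: "inj \<kappa> \<Longrightarrow> inj (label_rank \<kappa>)"
  by (intro injI) (metis injD linorder_neq_iff label_rank_less_iff)

lemma range_label_rank:
  fixes \<kappa> :: "'j::finite \<Rightarrow> nat"
  assumes "inj \<kappa>"
  shows "range (label_rank \<kappa>) = {..CARD('j) - 1}"
proof (rule card_subset_eq)
  show "card (range (label_rank \<kappa>)) = card {..CARD('j) - 1}"
    using card_image[OF inj_label_rank[OF assms]] zero_less_card_finite[where 'a='j] by simp
qed (use label_rank_le[of \<kappa>] in auto)

lemma int_rotate_cdiff:
  assumes "0 \<le> a" "a \<le> d" "0 \<le> b" "b \<le> d" "0 \<le> k" "k \<le> d"
  shows "int_cdiff d b a = int_cdiff d (int_cdiff d b k) (int_cdiff d a k)"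
  using assms unfolding int_cdiff_def by (smt (z3))

lemma int_cdiff_bounds: "\<lbrakk>0 \<le> a; a \<le> d; 0 \<le> b; b \<le> d\<rbrakk> \<Longrightarrow> 0 \<le> int_cdiff d a b \<and> int_cdiff d a b \<le> d"
  by (simp add: int_cdiff_def)

text \<open>\<open>P\<close> plays the predecessor of \<open>A\<close>: going up from
  \<open>P\<close>, neither \<open>B\<close> nor \<open>B'\<close> comes before \<open>A\<close>, so
  counting from \<open>A\<close> instead of \<open>P\<close> lowers both distances by the same
  amount.\<close>

lemma int_cdiff_predecessor_left:
  assumes "int_cdiff n A P \<le> int_cdiff n B P" "int_cdiff n A P \<le> int_cdiff n B' P"
    and "0 \<le> A" "A \<le> n" "0 \<le> B" "B \<le> n" "0 \<le> B'" "B' \<le> n" "0 \<le> P" "P \<le> n"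
  shows "int_cdiff n B P < int_cdiff n B' P \<longleftrightarrow> int_cdiff n B A < int_cdiff n B' A"
  using assms unfolding int_cdiff_def by (smt (z3))

text \<open>Going up from \<open>P\<close>, neither \<open>B\<close> nor \<open>A'\<close> comes
  before \<open>A\<close>; going up from \<open>P'\<close>, neither \<open>B\<close> nor
  \<open>A\<close> comes before \<open>A'\<close>. Seen from \<open>B\<close>, the two predecessors
  therefore come in the same order as \<open>A\<close> and \<open>A'\<close>.\<close>

lemma int_cdiff_predecessor_right:
  assumes "int_cdiff n A P \<le> int_cdiff n B P" "int_cdiff n A' P' \<le> int_cdiff n B P'"
    "int_cdiff n A P \<le> int_cdiff n A' P" "int_cdiff n A' P' \<le> int_cdiff n A P'"
    and "0 \<le> A" "A \<le> n" "0 \<le> B" "B \<le> n" "0 \<le> A'" "A' \<le> n" "0 \<le> P" "P \<le> n" "0 \<le> P'" "P' \<le> n"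
    and "A \<noteq> A'"
  shows "int_cdiff n B P < int_cdiff n B P' \<longleftrightarrow> int_cdiff n B A < int_cdiff n B A'"
  using assms unfolding int_cdiff_def by (smt (z3))

text \<open>Which of two cyclic distances with a common end is smaller depends only on the linear
  order of the three points, so an increasing relabelling preserves it.\<close>

lemma int_cdiff_monotone_left:
  assumes "0 \<le> A" "A \<le> n" "0 \<le> B" "B \<le> n" "0 \<le> B'" "B' \<le> n"
    and "0 \<le> a" "a \<le> d" "0 \<le> b" "b \<le> d" "0 \<le> b'" "b' \<le> d"
    and "a < b \<longleftrightarrow> A < B" "a < b' \<longleftrightarrow> A < B'" "b < b' \<longleftrightarrow> B < B'"
    and "b < a \<longleftrightarrow> B < A" "b' < a \<longleftrightarrow> B' < A" "b' < b \<longleftrightarrow> B' < B"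
  shows "int_cdiff n B A < int_cdiff n B' A \<longleftrightarrow> int_cdiff d b a < int_cdiff d b' a"
  using assms unfolding int_cdiff_def by (smt (z3))

lemma int_cdiff_monotone_right:
  assumes "0 \<le> B" "B \<le> n" "0 \<le> A" "A \<le> n" "0 \<le> A'" "A' \<le> n"
    and "0 \<le> b" "b \<le> d" "0 \<le> a" "a \<le> d" "0 \<le> a'" "a' \<le> d"
    and "a < b \<longleftrightarrow> A < B" "a' < b \<longleftrightarrow> A' < B" "a < a' \<longleftrightarrow> A < A'"
    and "b < a \<longleftrightarrow> B < A" "b < a' \<longleftrightarrow> B < A'" "a' < a \<longleftrightarrow> A' < A"
  shows "int_cdiff n B A < int_cdiff n B A' \<longleftrightarrow> int_cdiff d b a < int_cdiff d b a'"
  using assms unfolding int_cdiff_def by (smt (z3))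

text \<open>The first cut of \<open>noncrossing_cut\<close> in rotated coordinates: \<open>k\<close>
  sits at 0, \<open>l\<close> at \<open>\<delta>\<close>, and \<open>s\<close> ends the longest
  shorter arc from 0. An arc with exactly one end above \<open>s\<close> and up to
  \<open>\<delta>\<close> crosses the arc to \<open>\<delta>\<close> or the one to \<open>s\<close>,
  or is ruled out by the next three assumptions.\<close>

lemma cut_below:
  assumes "\<not> int_cross d A B 0 \<delta>" "\<not> int_cross d A B 0 s"
    and "A = 0 \<Longrightarrow> B < \<delta> \<Longrightarrow> B \<le> s" "B = \<delta> \<Longrightarrow> A \<le> \<delta>" "\<not> (A = 0 \<and> B = \<delta>)"
    and "0 \<le> s" "s < \<delta>" "\<delta> \<le> d" "0 \<le> A" "A \<le> d" "0 \<le> B" "B \<le> d"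
  shows "s < A \<and> A \<le> \<delta> \<longleftrightarrow> s < B \<and> B \<le> \<delta>"
  using assms unfolding int_cross_def int_cdiff_def by (smt (z3))

text \<open>The second cut, with \<open>s\<close> the start of the longest shorter arc into
  \<open>\<delta>\<close>: the cut set is now everything below \<open>s\<close>. The arc from
  \<open>A1\<close>, longer than \<open>(0, \<delta>)\<close>, excludes arcs from 0 that end beyond
  \<open>\<delta>\<close>.\<close>

lemma cut_above:
  assumes "\<not> int_cross d A B 0 \<delta>" "\<not> int_cross d A B s \<delta>" "\<not> int_cross d A B A1 \<delta>"
    and "B = \<delta> \<Longrightarrow> 0 < A \<Longrightarrow> A \<le> \<delta> \<Longrightarrow> s \<le> A" "\<not> (A = 0 \<and> B = \<delta>)"
    and "0 < s" "s \<le> \<delta>" "\<delta> < A1" "A1 \<le> d" "0 \<le> A" "A \<le> d" "0 \<le> B" "B \<le> d"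
  shows "A < s \<longleftrightarrow> B < s"
  using assms unfolding int_cross_def int_cdiff_def by (smt (z3))

text \<open>
  The set \<open>D\<close> is, up to complement, an interval between \<open>k\<close> and \<open>l\<close>. If no arc into \<open>l\<close> is longer
  than \<open>(k, l)\<close>, it is cut off after the longest arc from \<open>k\<close> shorter than \<open>(k, l)\<close>; otherwise no
  arc from \<open>k\<close> is longer than \<open>(k, l)\<close>, and it is cut off before the longest arc into \<open>l\<close> shorter
  than \<open>(k, l)\<close>.
\<close>

lemma noncrossing_cut:
  assumes T: "finite T" "\<And>a b. (a, b) \<in> T \<Longrightarrow> a \<le> d \<and> b \<le> d"
    "\<And>p q. p \<in> T \<Longrightarrow> q \<in> T \<Longrightarrow> \<not> cyc_cross d p q"
    and diag: "\<And>a. a \<le> d \<Longrightarrow> (a, a) \<in> T" and kl: "(k, l) \<in> T" "k \<noteq> l"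
  obtains D where "\<And>a b. (a, b) \<in> T \<Longrightarrow> (a, b) \<noteq> (k, l) \<Longrightarrow> a \<in> D \<longleftrightarrow> b \<in> D" "k \<in> D" "l \<notin> D"
proof -
  have kd: "k \<le> d" "l \<le> d"
    using T(2)[OF kl(1)] by auto
  \<comment> \<open>Rotates the circle so that \<open>k\<close> becomes 0.\<close>
  define q where "q = (\<lambda>x. int_cdiff (int d) (int x) (int k))"
  define \<delta> where "\<delta> = q l"
  have q_bounds: "0 \<le> q x" "q x \<le> int d" if "x \<le> d" for x
    using int_cdiff_bounds[of "int x" "int d" "int k"] that kd by (auto simp: q_def)
  have q_inj: "x = y" if "q x = q y" "x \<le> d" "y \<le> d" for x y
    using that kd by (simp add: q_def int_cdiff_def split: if_splits)
  have qk: "q k = 0"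
    by (simp add: q_def int_cdiff_def)
  have \<delta>: "0 < \<delta>" "\<delta> \<le> int d"
    using q_bounds[OF kd(2)] q_inj[of l k] qk kl(2) kd by (auto simp: \<delta>_def order_less_le)
  have cross: "\<not> int_cross (int d) (q a) (q b) (q a') (q b')" if "(a, b) \<in> T" "(a', b') \<in> T" for a b a' b'
  proof -
    have le: "a \<le> d" "b \<le> d" "a' \<le> d" "b' \<le> d"
      using T(2) that by auto
    have rot: "int_cdiff (int d) (q y) (q x) = int_cdiff (int d) (int y) (int x)" if "x \<le> d" "y \<le> d" for x y
      unfolding q_def using that kd by (intro int_rotate_cdiff[symmetric]) auto
    show ?thesis
      using T(3)[OF that] unfolding cyc_cross_int[OF le] int_cross_def by (simp add: rot le)
  qed
  show thesis
  proof (cases "\<exists>a. (a, l) \<in> T \<and> \<delta> < q a")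
    case False
    define S where "S = q ` {b. (k, b) \<in> T \<and> q b < \<delta>}"
    have "finite S"
      unfolding S_def by (rule finite_imageI, rule finite_subset[of _ "snd ` T"]) (use T(1) in force)+
    \<comment> \<open>The arc \<open>(k, k)\<close> keeps the set of candidates nonempty.\<close>
    moreover have "0 \<in> S"
      unfolding S_def using diag[OF kd(1)] qk \<delta>(1) by force
    ultimately have s: "Max S \<in> S" "\<And>y. y \<in> S \<Longrightarrow> y \<le> Max S"
      by (auto intro: Max_in)
    then obtain c where c: "(k, c) \<in> T" "q c < \<delta>" "Max S = q c"
      by (auto simp: S_def)
    have "q c < q a \<and> q a \<le> \<delta> \<longleftrightarrow> q c < q b \<and> q b \<le> \<delta>" if ab: "(a, b) \<in> T" "(a, b) \<noteq> (k, l)" for a b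
    proof (rule cut_below)
      have le: "a \<le> d" "b \<le> d"
        using T(2)[OF ab(1)] by auto
      show "\<not> int_cross (int d) (q a) (q b) 0 \<delta>" "\<not> int_cross (int d) (q a) (q b) 0 (q c)"
        using cross[OF ab(1) kl(1)] cross[OF ab(1) c(1)] by (auto simp: qk \<delta>_def)
      show "q b \<le> q c" if "q a = 0" "q b < \<delta>"
        using q_inj[of a k] that qk le kd ab(1) s(2)[of "q b"] c(3) by (auto simp: S_def)
      show "q a \<le> \<delta>" if "q b = \<delta>"
        using q_inj[of b l] that le kd ab(1) False by (auto simp: \<delta>_def)
      show "\<not> (q a = 0 \<and> q b = \<delta>)"
        using q_inj[of a k] q_inj[of b l] qk le kd ab(2) by (auto simp: \<delta>_def)
      show "0 \<le> q c" "q c < \<delta>" "\<delta> \<le> int d" "0 \<le> q a" "q a \<le> int d" "0 \<le> q b" "q b \<le> int d"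
        using q_bounds le T(2)[OF c(1)] c(2) \<delta>(2) by auto
    qed
    moreover have "\<not> (q c < q k \<and> q k \<le> \<delta>)" "q c < q l \<and> q l \<le> \<delta>"
      using c(2) qk q_bounds[of c] T(2)[OF c(1)] by (auto simp: \<delta>_def)
    \<comment> \<open>The complement of the interval is taken because \<open>k\<close> has to lie in
      \<open>D\<close>.\<close>
    ultimately show thesis
      using that[of "{x. \<not> (q c < q x \<and> q x \<le> \<delta>)}"] by auto
  next
    case True
    then obtain a1 where a1: "(a1, l) \<in> T" "\<delta> < q a1"
      by blast
    define S where "S = q ` {a. (a, l) \<in> T \<and> 0 < q a \<and> q a \<le> \<delta>}"
    have "finite S"
      unfolding S_def by (rule finite_imageI, rule finite_subset[of _ "fst ` T"]) (use T(1) in force)+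
    moreover have "\<delta> \<in> S"
      unfolding S_def using diag[OF kd(2)] \<delta>(1) by (force simp: \<delta>_def)
    ultimately have s: "Min S \<in> S" "\<And>y. y \<in> S \<Longrightarrow> Min S \<le> y"
      by (auto intro: Min_in)
    then obtain c where c: "(c, l) \<in> T" "0 < q c" "q c \<le> \<delta>" "Min S = q c"
      by (auto simp: S_def)
    have "q a < q c \<longleftrightarrow> q b < q c" if ab: "(a, b) \<in> T" "(a, b) \<noteq> (k, l)" for a b
    proof (rule cut_above)
      have le: "a \<le> d" "b \<le> d"
        using T(2)[OF ab(1)] by auto
      show "\<not> int_cross (int d) (q a) (q b) 0 \<delta>" "\<not> int_cross (int d) (q a) (q b) (q c) \<delta>"
        "\<not> int_cross (int d) (q a) (q b) (q a1) \<delta>"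
        using cross[OF ab(1) kl(1)] cross[OF ab(1) c(1)] cross[OF ab(1) a1(1)] by (auto simp: qk \<delta>_def)
      show "q c \<le> q a" if "q b = \<delta>" "0 < q a" "q a \<le> \<delta>"
        using q_inj[of b l] that le kd ab(1) s(2)[of "q a"] c(4) by (auto simp: \<delta>_def S_def)
      show "\<not> (q a = 0 \<and> q b = \<delta>)"
        using q_inj[of a k] q_inj[of b l] qk le kd ab(2) by (auto simp: \<delta>_def)
      show "0 < q c" "q c \<le> \<delta>" "\<delta> < q a1" "q a1 \<le> int d" "0 \<le> q a" "q a \<le> int d" "0 \<le> q b" "q b \<le> int d"
        using q_bounds le T(2)[OF a1(1)] c(2,3) a1(2) by auto
    qed
    moreover have "q k < q c" "\<not> q l < q c"
      using c(2,3) qk by (auto simp: \<delta>_def)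
    ultimately show thesis
      using that[of "{x. q x < q c}"] by auto
  qed
qed

text \<open>Crossing asks for a cyclic difference strictly smaller than the lengths of both arcs,
  and \<open>(a, a)\<close> has length 0.\<close>

lemma cyc_cross_diagonal:
  "\<lbrakk>a \<le> d; k \<le> d; l \<le> d\<rbrakk> \<Longrightarrow> \<not> cyc_cross d (a, a) (k, l) \<and> \<not> cyc_cross d (k, l) (a, a)"
  by (simp add: cyc_cross_iff cdiff_eq)

section \<open>The cyclohedron\<close>

text \<open>Here \<open>p b\<close> is the element cyclically preceding \<open>\<kappa> b\<close> in the disjoint union of \<open>I\<close> and \<open>J\<close>.\<close>

locale alternating_arrangement =
  fixes n :: nat and I :: "nat set" and \<kappa> :: "'j::finite \<Rightarrow> nat" and \<iota> :: "'i::finite \<Rightarrow> nat"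
    and h :: "nat \<Rightarrow> nat \<Rightarrow> real" and p :: "'j \<Rightarrow> nat"
    and d :: nat
  assumes d_eq: "d = CARD('j) - 1"
    and I_le: "I \<subseteq> {0..n}" and \<kappa>_le: "\<And>b. \<kappa> b \<le> n" and inj_\<kappa>: "inj \<kappa>" and card_J: "CARD('j) \<ge> 2"
    and range_\<iota>: "range \<iota> = I" and height: "cyclic_height n \<iota> \<kappa> h"
    and p_in: "\<And>b. p b \<in> I"
    and p_nearest: "\<And>b i. i \<in> I \<Longrightarrow> cdiff n (\<kappa> b) (p b) \<le> cdiff n (\<kappa> b) i"
    and p_last: "\<And>b c. cdiff n (\<kappa> b) (p b) \<le> cdiff n (\<kappa> c) (p b)"
begin

abbreviation "argmax \<equiv> argmax_set \<kappa> h"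
abbreviation "P \<equiv> covering I \<kappa> h"
abbreviation "r \<equiv> label_rank \<kappa>"

lemma finite_I: "finite I"
  using I_le finite_subset by blast

lemma p_le: "p b \<le> n"
  using p_in[of b] I_le by auto

lemma noncrossing:
  "\<lbrakk>i \<in> I; i' \<in> I; b \<in> argmax i x; b' \<in> argmax i' x\<rbrakk> \<Longrightarrow> \<not> cyc_cross n (i, \<kappa> b) (i', \<kappa> b')"
  using argmax_set_noncrossing[OF height] range_\<iota> by simp

text \<open>Were \<open>b\<close> not a maximiser of row \<open>p b\<close>, a maximiser
  \<open>c\<close> of that row would give an arc crossing the one from \<open>i\<close> to
  \<open>b\<close>: the distance from \<open>p b\<close> to \<open>b\<close> is smaller than both
  lengths.\<close>

lemma argmax_predecessor:
  assumes "i \<in> I" "b \<in> argmax i x"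
  shows "b \<in> argmax (p b) x"
proof (rule ccontr)
  assume b: "b \<notin> argmax (p b) x"
  obtain c where c: "c \<in> argmax (p b) x"
    using argmax_set_nonempty by blast
  have "c \<noteq> b" "i \<noteq> p b"
    using b c assms by auto
  then have "cdiff n (\<kappa> b) (p b) \<noteq> cdiff n (\<kappa> c) (p b)" "cdiff n (\<kappa> b) (p b) \<noteq> cdiff n (\<kappa> b) i"
    using cdiff_inj[of "\<kappa> b" n "\<kappa> c" "p b"] cdiff_inj_right[of "p b" n i "\<kappa> b"] \<kappa>_le p_le assms(1) I_le inj_\<kappa>
    by (auto dest: injD)
  then have "cyc_cross n (p b, \<kappa> c) (i, \<kappa> b)"
    using p_last[of b c] p_nearest[OF assms(1), of b] by (simp add: cyc_cross_iff)
  then show False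
    using noncrossing[OF p_in assms(1) c assms(2)] by blast
qed

lemma covering_iff: "x \<in> P \<longleftrightarrow> x \<in> last_coord_zero \<kappa> \<and> (\<forall>b. b \<in> argmax (p b) x)"
  unfolding covering_def using argmax_predecessor p_in by blast

text \<open>Lets the results on \<open>closed_cell\<close> be used with rows \<open>range p\<close>
  alone; these coarser cells will be the faces of \<open>P\<close>.\<close>

lemma covering_range_p: "covering (range p) \<kappa> h = P"
proof (intro set_eqI iffI)
  fix x assume x: "x \<in> covering (range p) \<kappa> h"
  then have "\<exists>i\<in>I. b \<in> argmax i x" for b
    using p_in by (force simp: covering_def)
  then show "x \<in> P"
    using x by (auto simp: covering_def)
next
  fix x assume "x \<in> P"
  then show "x \<in> covering (range p) \<kappa> h"
    unfolding covering_iff by (auto simp: covering_def)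
qed

text \<open>On \<open>P\<close> row \<open>p b\<close> always has the maximiser \<open>b\<close>,
  which is the common maximiser that \<open>argmax_set_segment\<close> asks for.\<close>

lemma segment_argmax:
  assumes "x \<in> P" "y \<in> P" "0 < t" "t < 1"
  shows "argmax (p b) ((1 - t) *\<^sub>R x + t *\<^sub>R y) = argmax (p b) x \<inter> argmax (p b) y"
  using assms by (intro argmax_set_segment[of b]) (auto simp: covering_iff)

lemma convex_P: "convex P"
  unfolding convex_alt
proof (intro ballI allI impI)
  fix x y and t :: real assume xy: "x \<in> P" "y \<in> P" and t: "0 \<le> t \<and> t \<le> 1"
  show "(1 - t) *\<^sub>R x + t *\<^sub>R y \<in> P"
  proof (cases "t = 0 \<or> t = 1")
    case False
    then have "argmax (p b) ((1 - t) *\<^sub>R x + t *\<^sub>R y) = argmax (p b) x \<inter> argmax (p b) y" for b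
      using t by (intro segment_argmax xy) auto
    then show ?thesis
      using xy by (simp add: covering_iff last_coord_zero_add last_coord_zero_scaleR)
  qed (use xy in auto)
qed

section \<open>Relabelling by ranks and the patterns of points\<close>

lemma r_le: "r b \<le> d"
  unfolding d_eq by (rule label_rank_le)

text \<open>Crossing only compares cyclic distances that share an end. In such comparisons each
  predecessor \<open>p a\<close> may first be replaced by \<open>\<kappa> a\<close>, and then every
  label by its rank.\<close>

lemma cross_label_rank:
  "cyc_cross n (p a, \<kappa> b) (p a', \<kappa> b') \<longleftrightarrow> cyc_cross d (r a, r b) (r a', r b')"
proof -
  have \<kappa>_eq: "int (\<kappa> x) = int (\<kappa> y) \<longleftrightarrow> x = y" for x y
    using inj_\<kappa> by (auto dest: injD)
  have r_less: "int (r x) < int (r y) \<longleftrightarrow> int (\<kappa> x) < int (\<kappa> y)" for x y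
    by (simp add: label_rank_less_iff)
  have near: "int_cdiff (int n) (int (\<kappa> x)) (int (p x)) \<le> int_cdiff (int n) (int (\<kappa> y)) (int (p x))" for x y
    using p_last[of x y] by (simp add: int_cdiff_eq \<kappa>_le p_le)
  have left: "cdiff n (\<kappa> y) (p x) < cdiff n (\<kappa> z) (p x) \<longleftrightarrow> cdiff d (r y) (r x) < cdiff d (r z) (r x)" for x y z
  proof -
    have "cdiff n (\<kappa> y) (p x) < cdiff n (\<kappa> z) (p x) \<longleftrightarrow>
        int_cdiff n (int (\<kappa> y)) (int (\<kappa> x)) < int_cdiff n (int (\<kappa> z)) (int (\<kappa> x))"
      unfolding int_cdiff_eq[OF \<kappa>_le p_le]
      using near[of x] by (intro int_cdiff_predecessor_left) (auto simp: \<kappa>_le p_le)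
    also have "\<dots> \<longleftrightarrow> int_cdiff d (int (r y)) (int (r x)) < int_cdiff d (int (r z)) (int (r x))"
      using r_less by (intro int_cdiff_monotone_left) (auto simp: r_le \<kappa>_le)
    finally show ?thesis
      by (simp only: int_cdiff_eq r_le)
  qed
  have right: "cdiff n (\<kappa> y) (p x) < cdiff n (\<kappa> y) (p z) \<longleftrightarrow> cdiff d (r y) (r x) < cdiff d (r y) (r z)" for x y z
  proof (cases "x = z")
    case False
    have "cdiff n (\<kappa> y) (p x) < cdiff n (\<kappa> y) (p z) \<longleftrightarrow>
        int_cdiff n (int (\<kappa> y)) (int (\<kappa> x)) < int_cdiff n (int (\<kappa> y)) (int (\<kappa> z))"
      unfolding int_cdiff_eq[OF \<kappa>_le p_le]
      using near[of x] near[of z] False \<kappa>_eq by (intro int_cdiff_predecessor_right) (auto simp: \<kappa>_le p_le)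
    also have "\<dots> \<longleftrightarrow> int_cdiff d (int (r y)) (int (r x)) < int_cdiff d (int (r y)) (int (r z))"
      using r_less by (intro int_cdiff_monotone_right) (auto simp: r_le \<kappa>_le)
    finally show ?thesis
      by (simp only: int_cdiff_eq r_le)
  qed simp
  show ?thesis
    unfolding cyc_cross_iff left right ..
qed

text \<open>Only the rows \<open>p a\<close> are recorded, with \<open>p a\<close> named by the rank
  of \<open>a\<close>. For normalised \<open>x\<close>, membership in \<open>P\<close> then means
  that all arcs \<open>(k, k)\<close> occur.\<close>

definition pattern :: "real ^ 'j \<Rightarrow> (nat \<times> nat) set" where
  "pattern x = {(r a, r b) | a b. b \<in> argmax (p a) x}"

lemma mem_pattern: "(r a, r b) \<in> pattern x \<longleftrightarrow> b \<in> argmax (p a) x"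
  using inj_label_rank[OF inj_\<kappa>] by (auto simp: pattern_def dest: injD)

lemma pattern_noncrossing:
  assumes "s \<in> pattern x" "t \<in> pattern x"
  shows "\<not> cyc_cross d s t"
proof -
  obtain a b a' b' where "s = (r a, r b)" "b \<in> argmax (p a) x" "t = (r a', r b')" "b' \<in> argmax (p a') x"
    using assms unfolding pattern_def by blast
  then show ?thesis
    using noncrossing[OF p_in p_in] by (simp add: cross_label_rank[symmetric])
qed

lemma pattern_le: "(a, b) \<in> pattern x \<Longrightarrow> a \<le> d \<and> b \<le> d"
  unfolding pattern_def using r_le by auto

lemma label_rankE:
  assumes "k \<le> d"
  obtains a where "k = r a"
  using range_label_rank[OF inj_\<kappa>] assms unfolding d_eq by (metis atMost_iff imageE)

lemma finite_pattern: "finite (pattern x)"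
  by (rule finite_subset[of _ "{..d} \<times> {..d}"]) (use pattern_le in auto)

lemma pattern_diagonal:
  assumes "x \<in> P" "k \<le> d"
  shows "(k, k) \<in> pattern x"
  using assms by (metis covering_iff label_rankE mem_pattern)

lemma mem_P_if_pattern:
  assumes "x \<in> last_coord_zero \<kappa>" "\<And>k. k \<le> d \<Longrightarrow> (k, k) \<in> pattern x"
  shows "x \<in> P"
  using assms(2)[OF r_le] assms(1) unfolding covering_iff mem_pattern by blast

text \<open>The cut of \<open>noncrossing_cut\<close> separates the ends of \<open>(k, l)\<close>
  and of no other arc. Moving along its indicator keeps all other ties and lets \<open>l\<close>
  fall behind in the row of \<open>k\<close>.\<close>

lemma remove_arc:
  assumes x: "x \<in> P" and kl: "(k, l) \<in> pattern x" "k \<noteq> l"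
  obtains y where "y \<in> P" "pattern y = pattern x - {(k, l)}"
proof -
  have "\<exists>D. (\<forall>a b. (a, b) \<in> pattern x \<longrightarrow> (a, b) \<noteq> (k, l) \<longrightarrow> (a \<in> D \<longleftrightarrow> b \<in> D)) \<and> k \<in> D \<and> l \<notin> D"
  proof (rule noncrossing_cut[of "pattern x" d k l])
    show "a \<le> d \<and> b \<le> d" if "(a, b) \<in> pattern x" for a b
      using that by (rule pattern_le)
    show "\<not> cyc_cross d s t" if "s \<in> pattern x" "t \<in> pattern x" for s t
      using that by (rule pattern_noncrossing)
    show "(a, a) \<in> pattern x" if "a \<le> d" for a
      using x that by (rule pattern_diagonal)
    fix D assume "\<And>a b. (a, b) \<in> pattern x \<Longrightarrow> (a, b) \<noteq> (k, l) \<Longrightarrow> a \<in> D \<longleftrightarrow> b \<in> D" "k \<in> D" "l \<notin> D"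
    then show ?thesis
      by blast
  qed (rule finite_pattern kl)+
  then obtain D where D: "\<And>a b. (a, b) \<in> pattern x \<Longrightarrow> (a, b) \<noteq> (k, l) \<Longrightarrow> a \<in> D \<longleftrightarrow> b \<in> D"
    and k: "k \<in> D" and l: "l \<notin> D"
    by blast
  define v0 :: "real ^ 'j" where "v0 = (\<chi> b. if r b \<in> D then 1 else 0)"
  \<comment> \<open>The constant \<open>s\<close> restores the last coordinate 0 and leaves the
    differences of coordinates unchanged.\<close>
  obtain s where s: "v0 + (\<chi> b. s) \<in> last_coord_zero \<kappa>"
    using normalise_last_coord[OF inj_\<kappa>] by blast
  define v where "v = v0 + (\<chi> b. s)"
  have v: "v $ b = (if r b \<in> D then 1 else 0) + s" for b
    by (simp add: v_def v0_def)
  obtain e where e: "e > 0" "\<And>t i. \<lbrakk>0 < t; t < e; i \<in> I\<rbrakk> \<Longrightarrow> argmax i (x + t *\<^sub>R v) =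
       {b \<in> argmax i x. \<forall>b'\<in>argmax i x. v $ b' \<le> v $ b}"
    by (rule argmax_set_local[OF finite_I]) (rule that)
  define y where "y = x + (e / 2) *\<^sub>R v"
  have y: "argmax (p a) y = {b \<in> argmax (p a) x. \<forall>b'\<in>argmax (p a) x. v $ b' \<le> v $ b}" for a
    unfolding y_def using e(1) by (intro e(2) p_in) auto
  have mem_y: "(r a, r b) \<in> pattern y \<longleftrightarrow> (r a, r b) \<in> pattern x \<and> (r a, r b) \<noteq> (k, l)" for a b
  proof -
    have ax: "a \<in> argmax (p a) x"
      using x by (simp add: covering_iff)
    have va: "v $ c = v $ a" if "c \<in> argmax (p a) x" "(r a, r c) \<noteq> (k, l)" for c
      using D[of "r a" "r c"] that by (simp add: mem_pattern v)
    have vl: "v $ c < v $ a" if "(r a, r c) = (k, l)" for c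
      using that k l by (auto simp: v)
    have le: "v $ c \<le> v $ a" if "c \<in> argmax (p a) x" for c
      using va[OF that] vl by (cases "(r a, r c) = (k, l)") (auto simp: less_imp_le)
    show ?thesis
    proof (cases "b \<in> argmax (p a) x")
      case True
      then have "(\<forall>b'\<in>argmax (p a) x. v $ b' \<le> v $ b) \<longleftrightarrow> (r a, r b) \<noteq> (k, l)"
        using va[OF True] vl[of b] le ax by (metis linorder_not_less)
      then show ?thesis
        using True by (simp add: mem_pattern y)
    qed (simp add: mem_pattern y)
  qed
  have "(a, b) \<in> pattern y \<longleftrightarrow> (a, b) \<in> pattern x - {(k, l)}" for a b
  proof (cases "a \<le> d \<and> b \<le> d")
    case True
    then obtain a' b' where "a = r a'" "b = r b'"
      by (metis label_rankE)
    then show ?thesis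
      using mem_y by auto
  qed (use pattern_le in blast)
  then have pat: "pattern y = pattern x - {(k, l)}"
    by auto
  have "y \<in> last_coord_zero \<kappa>"
    using x s unfolding y_def v_def covering_iff by (auto intro!: last_coord_zero_add last_coord_zero_scaleR)
  then have "y \<in> P"
    using pattern_diagonal[OF x] kl(2) by (intro mem_P_if_pattern) (auto simp: pat)
  then show thesis
    using that pat by blast
qed

lemma remove_arcs:
  assumes "finite R" "x \<in> P" "R \<subseteq> pattern x" "\<And>k. (k, k) \<notin> R"
  obtains y where "y \<in> P" "pattern y = pattern x - R"
  using assms
proof (induction R arbitrary: thesis rule: finite_induct)
  case empty
  then show ?case by auto
next
  case (insert e R)
  obtain y where y: "y \<in> P" "pattern y = pattern x - R"
    using insert.IH insert.prems by auto
  obtain k l where e: "e = (k, l)"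
    by (cases e)
  have "(k, l) \<in> pattern y" "k \<noteq> l"
    using insert e y(2) by auto
  then obtain z where "z \<in> P" "pattern z = pattern y - {(k, l)}"
    using remove_arc[OF y(1)] by metis
  then show ?case
    using insert.prems(1)[of z] y(2) e by auto
qed

text \<open>Read through \<open>cross_label_rank\<close>, \<open>T\<close> is a noncrossing set of
  arcs over \<open>I\<close> and \<open>J\<close> and extends to a cyclic tree, which some point
  realises. The surplus arcs are then removed; none of them is an arc \<open>(k, k)\<close>, since
  all of these lie in \<open>T\<close>.\<close>

lemma realise_pattern:
  assumes T: "T \<subseteq> {..d} \<times> {..d}" "\<And>s t. s \<in> T \<Longrightarrow> t \<in> T \<Longrightarrow> \<not> cyc_cross d s t"
    and diag: "\<And>k. k \<le> d \<Longrightarrow> (k, k) \<in> T"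
  obtains x where "x \<in> P" "pattern x = T"
proof -
  let ?J = "range \<kappa>"
  define U where "U = {(p a, \<kappa> b) | a b. (r a, r b) \<in> T}"
  have "noncrossing_arcs n I ?J U"
    unfolding noncrossing_arcs_def
  proof (intro conjI ballI)
    show "U \<subseteq> I \<times> ?J"
      using p_in by (auto simp: U_def)
    fix s t assume "s \<in> U" "t \<in> U"
    then show "\<not> cyc_cross n s t"
      using T(2) by (auto simp: U_def cross_label_rank)
  qed
  moreover have "finite {V. noncrossing_arcs n I ?J V}"
    by (rule finite_subset[of _ "Pow (I \<times> ?J)"]) (use finite_I in \<open>auto simp: noncrossing_arcs_def\<close>)
  ultimately obtain V where V: "noncrossing_arcs n I ?J V" "U \<subseteq> V"
    "\<forall>V'\<in>{V. noncrossing_arcs n I ?J V}. V \<subseteq> V' \<longrightarrow> V' = V"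
    using finite_has_maximal2[of "{V. noncrossing_arcs n I ?J V}" U] by (metis mem_Collect_eq)
  then have "V \<in> cyclic_trees n (range \<iota>) ?J"
    by (simp add: cyclic_trees_def range_\<iota>)
  then obtain x0 where x0: "\<And>i b. (i, \<kappa> b) \<in> V \<Longrightarrow> argmax i x0 = {b. (i, \<kappa> b) \<in> V}"
    by (rule cyclic_tree_argmax_set[OF height]) (rule that)
  obtain s where s: "x0 + (\<chi> b. s) \<in> last_coord_zero \<kappa>"
    using normalise_last_coord[OF inj_\<kappa>] by blast
  define x where "x = x0 + (\<chi> b. s)"
  have x: "argmax i x = argmax i x0" for i
    by (simp add: x_def argmax_set_translate)
  \<comment> \<open>The arcs \<open>(k, k)\<close> ensure that each row \<open>p a\<close> meets
    \<open>V\<close>, as the realisation by \<open>x0\<close> requires.\<close>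
  have "(p a, \<kappa> a) \<in> V" for a
    using diag[OF r_le] V(2) by (auto simp: U_def)
  then have row: "argmax (p a) x = {b. (p a, \<kappa> b) \<in> V}" for a
    unfolding x by (rule x0)
  have "T \<subseteq> pattern x"
  proof
    fix t assume t: "t \<in> T"
    then obtain k l where kl: "t = (k, l)" "k \<le> d" "l \<le> d"
      using T(1) by auto
    then obtain a b where ab: "k = r a" "l = r b"
      by (metis label_rankE)
    then have "(p a, \<kappa> b) \<in> V"
      using t kl V(2) by (auto simp: U_def)
    then show "t \<in> pattern x"
      by (simp add: kl ab mem_pattern row)
  qed
  moreover have "x \<in> P"
    using \<open>T \<subseteq> pattern x\<close> diag s by (intro mem_P_if_pattern) (auto simp: x_def)
  ultimately obtain y where "y \<in> P" "pattern y = pattern x - (pattern x - T)"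
    using remove_arcs[of "pattern x - T" x] finite_pattern pattern_le diag by (metis DiffE Diff_subset finite_Diff)
  then show thesis
    using that \<open>T \<subseteq> pattern x\<close> by (simp add: double_diff)
qed

section \<open>Faces and dimension of the support\<close>

abbreviation "face \<equiv> closed_cell (range p) \<kappa> h"

lemma face_subset_P: "x \<in> P \<Longrightarrow> face x \<subseteq> P"
  using closed_cell_subset_covering[of x "range p"] covering_range_p by blast

lemma mem_face_iff:
  assumes "y \<in> P"
  shows "y \<in> face x \<longleftrightarrow> pattern x \<subseteq> pattern y"
proof -
  have "y \<in> face x \<longleftrightarrow> (\<forall>a. argmax (p a) x \<subseteq> argmax (p a) y)"
    using assms by (auto simp: closed_cell_def covering_def)
  also have "\<dots> \<longleftrightarrow> pattern x \<subseteq> pattern y"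
    using mem_pattern unfolding pattern_def[of x] by blast
  finally show ?thesis .
qed

lemma face_subset_iff:
  assumes "x \<in> P" "y \<in> P"
  shows "face x \<subseteq> face y \<longleftrightarrow> pattern y \<subseteq> pattern x"
proof
  assume "face x \<subseteq> face y"
  then have "x \<in> face y"
    using mem_face_iff[OF assms(1)] by blast
  then show "pattern y \<subseteq> pattern x"
    using mem_face_iff[OF assms(1)] by blast
next
  assume "pattern y \<subseteq> pattern x"
  then show "face x \<subseteq> face y"
    using mem_face_iff face_subset_P[OF assms(1)] by blast
qed

text \<open>For \<open>x\<close> in the relative interior of a face \<open>F\<close>, segments of
  \<open>F\<close> through \<open>x\<close> show that the maximisers at \<open>x\<close> persist on
  \<open>F\<close>, and prolonging segments of \<open>face x\<close> beyond \<open>x\<close> makes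
  \<open>F\<close> absorb their ends. Conversely, by \<open>segment_argmax\<close>, a point of
  \<open>face x\<close> inside a segment of \<open>P\<close> forces both ends into
  \<open>face x\<close>.\<close>

lemma face_of_P_iff: "F face_of P \<and> F \<noteq> {} \<longleftrightarrow> (\<exists>x\<in>P. F = face x)"
proof
  assume F: "F face_of P \<and> F \<noteq> {}"
  then have "convex F" "F \<subseteq> P"
    by (auto simp: face_of_def)
  then obtain x where x: "x \<in> rel_interior F"
    using F rel_interior_eq_empty by blast
  then have "x \<in> F"
    using rel_interior_subset by blast
  then have xP: "x \<in> P"
    using \<open>F \<subseteq> P\<close> by blast
  have "F \<subseteq> face x"
  proof
    fix y assume y: "y \<in> F"
    obtain e where e: "e > 1" "(1 - e) *\<^sub>R y + e *\<^sub>R x \<in> F"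
      using x y convex_rel_interior_iff[OF \<open>convex F\<close>] F by blast
    define z where "z = (1 - e) *\<^sub>R y + e *\<^sub>R x"
    define t where "t = 1 / e"
    have t: "0 < t" "t < 1" "t * e = 1"
      using e by (auto simp: t_def)
    have "(1 - t) *\<^sub>R y + t *\<^sub>R z = (1 - t * e) *\<^sub>R y + (t * e) *\<^sub>R x"
      by (simp add: z_def algebra_simps)
    then have "x = (1 - t) *\<^sub>R y + t *\<^sub>R z"
      by (simp add: t)
    then have "argmax (p a) x \<subseteq> argmax (p a) y" for a
      using segment_argmax[of y z t a] y e(2) t \<open>F \<subseteq> P\<close> by (auto simp: z_def)
    then show "y \<in> face x"
      using y \<open>F \<subseteq> P\<close> by (auto simp: closed_cell_def covering_def)
  qed
  moreover have "face x \<subseteq> F"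
  proof
    fix y assume y: "y \<in> face x"
    have "x \<in> last_coord_zero \<kappa>"
      using xP by (simp add: covering_def)
    then obtain z t where z: "z \<in> face x" "0 < t" "t < (1::real)" "x = (1 - t) *\<^sub>R y + t *\<^sub>R z"
      using closed_cell_extend[of "range p", OF _ _ y] by (metis finite_class.finite_UNIV finite_imageI)
    show "y \<in> F"
    proof (cases "y = z")
      case True
      then have "x = y"
        using z(4) by (simp flip: scaleR_add_left)
      then show ?thesis using \<open>x \<in> F\<close> by simp
    next
      case False
      then have "x \<in> open_segment y z"
        using z(2-4) by (auto simp: in_segment)
      then show ?thesis
        using F \<open>x \<in> F\<close> y z(1) face_subset_P[OF xP] unfolding face_of_def by blast
    qed
  qed
  ultimately show "\<exists>x\<in>P. F = face x"
    using xP by blast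
next
  assume "\<exists>x\<in>P. F = face x"
  then obtain x where x: "x \<in> P" "F = face x"
    by blast
  have "face x face_of P"
    unfolding face_of_def
  proof (intro conjI ballI impI)
    show "face x \<subseteq> P"
      by (rule face_subset_P[OF x(1)])
    show "convex (face x)"
      by (rule convex_closed_cell)
    fix a b z assume ab: "a \<in> P" "b \<in> P" and z: "z \<in> face x" "z \<in> open_segment a b"
    obtain t where t: "0 < t" "t < 1" "z = (1 - t) *\<^sub>R a + t *\<^sub>R b"
      using z(2) by (auto simp: in_segment)
    have "argmax (p c) x \<subseteq> argmax (p c) a \<inter> argmax (p c) b" for c
      using z(1) segment_argmax[OF ab t(1,2), of c] unfolding t(3)[symmetric] by (auto simp: closed_cell_def)
    then show "a \<in> face x" "b \<in> face x"
      using ab by (auto simp: closed_cell_def covering_def)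
  qed
  moreover have "face x \<noteq> {}"
    using mem_face_iff[OF x(1)] by blast
  ultimately show "F face_of P \<and> F \<noteq> {}"
    using x(2) by blast
qed

lemma pattern_subset_iff_proper:
  assumes "x \<in> P" "y \<in> P"
  shows "pattern x \<subseteq> pattern y \<longleftrightarrow> pattern x \<inter> proper_arcs d \<subseteq> pattern y \<inter> proper_arcs d"
proof
  assume sub: "pattern x \<inter> proper_arcs d \<subseteq> pattern y \<inter> proper_arcs d"
  show "pattern x \<subseteq> pattern y"
  proof
    fix t assume t: "t \<in> pattern x"
    then show "t \<in> pattern y"
      using sub pattern_le[of _ _ x] pattern_diagonal[OF assms(2)]
      by (cases t; cases "fst t = snd t") (auto simp: proper_arcs_def)
  qed
qed auto

text \<open>A point whose only arcs are the \<open>(k, k)\<close> satisfies the defining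
  inequalities of \<open>P\<close> strictly, so \<open>P\<close> contains a nonempty relatively open
  part of the hyperplane of normalised points.\<close>

lemma aff_dim_P: "aff_dim P = int d"
proof -
  let ?diag = "{(k, k) | k. k \<le> d}"
  have "?diag \<subseteq> {..d} \<times> {..d}" "\<And>s t. s \<in> ?diag \<Longrightarrow> t \<in> ?diag \<Longrightarrow> \<not> cyc_cross d s t"
    "\<And>k. k \<le> d \<Longrightarrow> (k, k) \<in> ?diag"
    using cyc_cross_diagonal by auto
  then obtain x where x: "x \<in> P" "pattern x = ?diag"
    by (rule realise_pattern)
  define W where "W = {y. \<forall>a. \<forall>b. b \<noteq> a \<longrightarrow> y $ b - h (p a) (\<kappa> b) < y $ a - h (p a) (\<kappa> a)}"
  have "open W"
  proof -
    have "W = (\<Inter>a. \<Inter>b\<in>- {a}. {y. y $ b - h (p a) (\<kappa> b) < y $ a - h (p a) (\<kappa> a)})"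
      by (auto simp: W_def)
    then show ?thesis
      by (auto intro!: open_INT open_Collect_less continuous_intros)
  qed
  have "argmax (p a) x = {a}" for a
  proof -
    have "b \<in> argmax (p a) x \<longleftrightarrow> b = a" for b
      unfolding mem_pattern[symmetric] x(2) using inj_label_rank[OF inj_\<kappa>] r_le
      by (auto dest: injD)
    then show ?thesis by auto
  qed
  then have "x \<in> W"
    unfolding W_def using mem_argmax_set_iff max_val_ge by (smt (verit) mem_Collect_eq singleton_iff)
  have "last_coord_zero \<kappa> \<inter> W \<subseteq> P"
  proof
    fix y assume y: "y \<in> last_coord_zero \<kappa> \<inter> W"
    then have "y $ b - h (p a) (\<kappa> b) \<le> y $ a - h (p a) (\<kappa> a)" for a b
      by (cases "b = a") (auto simp: W_def less_imp_le)
    then show "y \<in> P"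
      using y by (simp add: covering_iff mem_argmax_set)
  qed
  have L: "last_coord_zero \<kappa> = {x. axis (last_index \<kappa>) 1 \<bullet> x = 0}"
    by (auto simp: last_coord_zero_iff[OF inj_\<kappa>] inner_axis')
  have "aff_dim (last_coord_zero \<kappa>) = int d"
    unfolding L by (subst aff_dim_hyperplane) (auto simp: d_eq)
  moreover have "aff_dim (last_coord_zero \<kappa> \<inter> W) = aff_dim (last_coord_zero \<kappa>)"
  proof (rule aff_dim_openin)
    show "affine (last_coord_zero \<kappa>)"
      unfolding L by (rule affine_hyperplane)
    show "last_coord_zero \<kappa> \<inter> W \<noteq> {}"
      using \<open>x \<in> W\<close> x(1) by (auto simp: covering_def)
    show "openin (top_of_set (last_coord_zero \<kappa>)) (last_coord_zero \<kappa> \<inter> W)"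
      using \<open>open W\<close> by (rule openin_open_Int)
  qed
  moreover have "aff_dim P \<le> aff_dim (last_coord_zero \<kappa>)"
    by (intro aff_dim_subset) (auto simp: covering_def)
  moreover have "aff_dim (last_coord_zero \<kappa> \<inter> W) \<le> aff_dim P"
    using \<open>last_coord_zero \<kappa> \<inter> W \<subseteq> P\<close> by (rule aff_dim_subset)
  ultimately show ?thesis by simp
qed

lemma regular_subdivision_P: "is_regular_subdivision_of (Cyclo I \<kappa> h) P"
  using p_in by (intro convex_covering_regular_subdivision finite_I inj_\<kappa> card_J convex_P) auto

text \<open>A face is sent to the dissection given by the proper arcs in the pattern of a generating
  point. Injectivity follows from the order equivalence, surjectivity from
  \<open>realise_pattern\<close>.\<close>

theorem classical_cyclohedron_P: "classical_cyclohedron d P"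
  unfolding classical_cyclohedron_def
proof (intro conjI)
  show "polytope P"
    using regular_subdivision_P unfolding is_regular_subdivision_of_def polytope_def by blast
  show "aff_dim P = int d"
    by (rule aff_dim_P)
  let ?faces = "{F. F face_of P \<and> F \<noteq> {}}"
  \<comment> \<open>The pattern is independent of this choice, because \<open>face x\<close>
    determines \<open>pattern x\<close> by \<open>face_subset_iff\<close>.\<close>
  define pt where "pt = (\<lambda>F. SOME x. x \<in> P \<and> F = face x)"
  define \<phi> where "\<phi> = (\<lambda>F. dissection_of_arcs d (pattern (pt F) \<inter> proper_arcs d))"
  have pt: "pt F \<in> P" "F = face (pt F)" if "F \<in> ?faces" for F
    using that someI_ex[of "\<lambda>x. x \<in> P \<and> F = face x"] face_of_P_iff[of F] unfolding pt_def by blast+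
  have order: "F \<subseteq> G \<longleftrightarrow> \<phi> G \<subseteq> \<phi> F" if "F \<in> ?faces" "G \<in> ?faces" for F G
  proof -
    have "F \<subseteq> G \<longleftrightarrow> pattern (pt G) \<subseteq> pattern (pt F)"
      using face_subset_iff[OF pt(1)[OF that(1)] pt(1)[OF that(2)]] pt(2)[OF that(1)] pt(2)[OF that(2)] by metis
    also have "\<dots> \<longleftrightarrow> \<phi> G \<subseteq> \<phi> F"
      unfolding \<phi>_def pattern_subset_iff_proper[OF pt(1)[OF that(2)] pt(1)[OF that(1)]]
      by (rule dissection_of_arcs_subset_iff[symmetric]) simp
    finally show ?thesis .
  qed
  have "\<phi> ` ?faces = symmetric_dissections d"
  proof (intro set_eqI iffI)
    fix X assume "X \<in> \<phi> ` ?faces"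
    then show "X \<in> symmetric_dissections d"
      unfolding symmetric_dissections_eq \<phi>_def using pattern_noncrossing by auto
  next
    fix X assume "X \<in> symmetric_dissections d"
    then obtain T where T: "X = dissection_of_arcs d T" "T \<subseteq> proper_arcs d"
      "\<And>s t. s \<in> T \<Longrightarrow> t \<in> T \<Longrightarrow> \<not> cyc_cross d s t"
      unfolding symmetric_dissections_eq by blast
    \<comment> \<open>Adding the arcs \<open>(k, k)\<close> meets the requirement of
      \<open>realise_pattern\<close> and creates no crossing.\<close>
    let ?T = "T \<union> {(k, k) | k. k \<le> d}"
    have "?T \<subseteq> {..d} \<times> {..d}"
      using T(2) by (auto simp: proper_arcs_def)
    moreover from this have "\<not> cyc_cross d s t" if "s \<in> ?T" "t \<in> ?T" for s t
      using T(3) that cyc_cross_diagonal[of _ d] by blast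
    ultimately obtain x where x: "x \<in> P" "pattern x = ?T"
      by (rule realise_pattern) auto
    have F: "face x \<in> ?faces"
      using face_of_P_iff[of "face x"] x(1) by blast
    have "pattern (pt (face x)) = pattern x"
      using face_subset_iff[OF pt(1)[OF F] x(1)] face_subset_iff[OF x(1) pt(1)[OF F]] pt(2)[OF F] by blast
    then have "\<phi> (face x) = X"
      using T(2) by (auto simp: \<phi>_def T(1) x(2) proper_arcs_def intro!: arg_cong[where f = "dissection_of_arcs d"])
    then show "X \<in> \<phi> ` ?faces"
      using F by blast
  qed
  moreover have "inj_on \<phi> ?faces"
  proof (rule inj_onI)
    fix F G assume FG: "F \<in> ?faces" "G \<in> ?faces" and "\<phi> F = \<phi> G"
    then show "F = G"
      using order[OF FG] order[OF FG(2,1)] by simp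
  qed
  ultimately show "\<exists>\<phi>. bij_betw \<phi> ?faces (symmetric_dissections d) \<and>
      (\<forall>F G. F face_of P \<and> F \<noteq> {} \<and> G face_of P \<and> G \<noteq> {} \<longrightarrow> (F \<subseteq> G \<longleftrightarrow> \<phi> G \<subseteq> \<phi> F))"
    using order by (intro exI[of _ \<phi>]) (auto simp: bij_betw_def)
qed

end

theorem theorem9p7:
  fixes n :: nat and I J :: "nat set"
    and \<iota> :: "'i::finite \<Rightarrow> nat" and \<kappa> :: "'j::finite \<Rightarrow> nat"
    and h :: "nat \<Rightarrow> nat \<Rightarrow> real"
  assumes "I \<subseteq> {0..n}" and "J \<subseteq> {0..n}"
    and "card I \<ge> 2" and "card J \<ge> 3"
    and "bij_betw \<iota> UNIV I" and "bij_betw \<kappa> UNIV J"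
    and "cyclic_height n \<iota> \<kappa> h"
  shows "(convex (\<Union> (Cyclo I \<kappa> h)) \<longleftrightarrow>
            \<not> (\<exists>j\<in>J. \<exists>j'\<in>J. cyc_consecutive (I <+> J) (Inr j) (Inr j'))) \<and>
         (convex (\<Union> (Cyclo I \<kappa> h)) \<longrightarrow>
            (\<exists>P. classical_cyclohedron (card J - 1) P \<and> is_regular_subdivision_of (Cyclo I \<kappa> h) P))"
proof -
  have \<kappa>: "inj \<kappa>" "range \<kappa> = J" and \<iota>: "range \<iota> = I"
    using assms(5,6) by (auto simp: bij_betw_def)
  have J_card: "CARD('j) = card J"
    using bij_betw_same_card[OF assms(6)] .
  have fin: "finite I"
    using assms(1) finite_subset by blast
  have support: "\<Union> (Cyclo I \<kappa> h) = covering I \<kappa> h"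
    using \<kappa>(1) fin J_card assms(4) by (intro Union_Cyclo) auto
  show ?thesis
  proof (cases "\<exists>j\<in>J. \<exists>j'\<in>J. cyc_consecutive (I <+> J) (Inr j) (Inr j')")
    case True
    then obtain j j' where "cyc_consecutive (I <+> J) (Inr j) (Inr j')"
      by blast
    then obtain i0 i1 b1 b2 c where "i0 \<in> I" "i1 \<in> I" "b1 \<in> J" "b2 \<in> J" "c \<in> J"
      and "\<And>i. i \<in> I \<Longrightarrow> i \<noteq> i0 \<Longrightarrow> cyc_cross n (i, b2) (i0, c)" "cyc_cross n (i0, b2) (i1, b1)"
      by (rule cyc_consecutive_crossings[OF assms(1-4)]) (rule that)
    moreover from this obtain b1' b2' c' where "b1 = \<kappa> b1'" "b2 = \<kappa> b2'" "c = \<kappa> c'"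
      using \<kappa>(2) by (metis imageE)
    ultimately have "\<not> convex (covering I \<kappa> h)"
      using argmax_set_noncrossing[OF assms(7)] \<iota> fin
      by (intro nonconvex_covering[where ?i0.0 = i0 and ?i1.0 = i1 and ?b1.0 = b1' and ?b2.0 = b2' and c = c']) auto
    then show ?thesis
      using True support by simp
  next
    case False
    \<comment> \<open>Without consecutive elements each \<open>\<kappa> b\<close> has a cyclic
      predecessor in \<open>I\<close>; choosing one for each \<open>b\<close> gives the function
      \<open>p\<close> of the locale.\<close>
    have "\<exists>i. i \<in> I \<and> (\<forall>i'\<in>I. cdiff n (\<kappa> b) i \<le> cdiff n (\<kappa> b) i') \<and>
        (\<forall>c. cdiff n (\<kappa> b) i \<le> cdiff n (\<kappa> c) i)" for b
    proof -
      have J: "\<kappa> c \<in> J" for c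
        using \<kappa>(2) by auto
      have "card J \<ge> 2"
        using assms(4) by simp
      then obtain i where "i \<in> I" "\<And>i'. i' \<in> I \<Longrightarrow> cdiff n (\<kappa> b) i \<le> cdiff n (\<kappa> b) i'"
        "\<And>c. c \<in> J \<Longrightarrow> cdiff n (\<kappa> b) i \<le> cdiff n c i"
        by (rule ex_cyclic_predecessor[OF assms(1,2) _ J]) (use False J that in blast)+
      then show ?thesis
        using J by blast
    qed
    then obtain p where p: "\<And>b. p b \<in> I" "\<And>b i'. i' \<in> I \<Longrightarrow> cdiff n (\<kappa> b) (p b) \<le> cdiff n (\<kappa> b) i'"
      "\<And>b c. cdiff n (\<kappa> b) (p b) \<le> cdiff n (\<kappa> c) (p b)"
      by metis
    have \<kappa>_n: "\<kappa> b \<le> n" for b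
      using rangeI[of \<kappa> b] \<kappa>(2) assms(2) by auto
    interpret alternating_arrangement n I \<kappa> \<iota> h p "CARD('j) - 1"
      by unfold_locales (use \<kappa>_n assms \<kappa> \<iota> J_card p in auto)
    show ?thesis
      using False convex_P classical_cyclohedron_P regular_subdivision_P support J_card by auto
  qed
qed

end
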